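(* Let the setting described in the context hold and let $\phi_0\in V_B^{\sigma_0}$ with $\hat\beta(\phi_0)\in L^1(\Omega)$. For $i=1,2$ let $f_i\in L^2(0,T;H)$ and let $(\phi_i,\mu_i)\in H^1(0,T;H)\times L^2(0,T;V_A^{2r})$ be a solution of the limiting problem with forcing term $f=f_i$, i.e. $$(\partial_t\phi_i(t),v)+(A^r\mu_i(t),A^rv)=0\quad\text{for every } v\in V_A^r \text{ and a.a. } t\in(0,T),$$ $$\tau(\partial_t\phi_i(t),\phi_i(t)-v)+(\phi_i(t)-P\phi_i(t),\phi_i(t)-v)+\int_\Omega\hat\beta(\phi_i(t))+(\pi(\phi_i(t))-f_i(t),\phi_i(t)-v)\le(\mu_i(t),\phi_i(t)-v)+\int_\Omega\hat\beta(v)$$ for every $v\in H$ and a.a. $t\in(0,T)$, and $\phi_i(0)=\phi_0$. Then $$\|\phi_1-\phi_2\|_{L^\infty(0,T;H)}\le C_{cd}\,\|f_1-f_2\|_{L^2(0,T;H)},$$ with a constant $C_{cd}$ depending only on $\tau$, the Lipschitz constant $L_\pi$ of $\pi$, and $T$. In particular, for $f\in L^2(0,T;H)$, the first component $\phi$ of a solution $(\phi,\mu)$ of the limiting problem is uniquely determined.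
   Context: $\Omega\subset\mathbb{R}^3$ is a bounded, connected, smooth open set, $H:=L^2(\Omega)$ with norm $\|\cdot\|$ and inner product $(\cdot,\cdot)$, $T>0$. $A:D(A)\subset H\to H$ and $B:D(B)\subset H\to H$ are unbounded, monotone, selfadjoint linear operators with compact resolvents; $\{\lambda_j\}$, $\{\lambda'_j\}$ are the nondecreasing sequences of their eigenvalues (nonnegative, tending to $+\infty$) with complete orthonormal eigenvector systems $\{e_j\}$, $\{e'_j\}$. For $s>0$, $A^sv:=\sum_j\lambda_j^s(v,e_j)e_j$ on $V_A^s:=D(A^s)=\{v\in H:\sum_j|\lambda_j^s(v,e_j)|^2<\infty\}$, and analogously $B^s$ on $V_B^s:=D(B^s)$ with norm $\|v\|^2+\|B^sv\|^2$. $P:H\to H$ is the orthogonal projection onto $\ker B$. $r,\sigma_0,\tau$ are fixed positive numbers. Standing structural assumptions: either $\lambda_1>0$, or $0=\lambda_1<\lambda_2$ and $e_1$ is constant; if $\lambda_1=0$, constant functions belong to $V_B^\sigma$ for $\sigma\in(0,\sigma_0)$. $F=\hat\beta+\hat\pi$, with $\hat\beta:\mathbb{R}\to[0,+\infty]$ convex, proper, lower semicontinuous, $\hat\beta(0)=0$; $\hat\pi:\mathbb{R}\to\mathbb{R}$ of class $C^1$ with Lipschitz continuous derivative $\pi:=\hat\pi'$ (Lipschitz constant $L_\pi$); $\liminf_{|s|\to\infty}s^{-2}F(s)>0$. Convention: $\int_\Omega\hat\beta(v):=+\infty$ if $\hat\beta(v)\notin L^1(\Omega)$. *)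

theory Defs
  imports "HOL-Analysis.Analysis"
begin

type_synonym pt = "real^3"
type_synonym fn = "pt \<Rightarrow> real"

text \<open>Elements of H = L2(Omega) (represented by functions; equality is a.e.).\<close>
definition L2 :: "pt set \<Rightarrow> fn \<Rightarrow> bool" where
  "L2 \<Omega> v \<longleftrightarrow> v \<in> borel_measurable (lebesgue_on \<Omega>) \<and> integrable (lebesgue_on \<Omega>) (\<lambda>x. (v x)^2)"

definition ip :: "pt set \<Rightarrow> fn \<Rightarrow> fn \<Rightarrow> real" where
  "ip \<Omega> v w = (\<integral>x. v x * w x \<partial>lebesgue_on \<Omega>)"

definition nrm :: "pt set \<Rightarrow> fn \<Rightarrow> real" where
  "nrm \<Omega> v = sqrt (ip \<Omega> v v)"

definition ONB :: "pt set \<Rightarrow> (nat \<Rightarrow> fn) \<Rightarrow> bool" where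
  "ONB \<Omega> e \<longleftrightarrow> (\<forall>j. L2 \<Omega> (e j)) \<and> (\<forall>i j. ip \<Omega> (e i) (e j) = (if i = j then 1 else 0)) \<and>
     (\<forall>v. L2 \<Omega> v \<longrightarrow> (\<lambda>n. nrm \<Omega> (\<lambda>x. v x - (\<Sum>j<n. ip \<Omega> v (e j) * e j x))) \<longlonglongrightarrow> 0)"

text \<open>Spectral data (eigenvalues lam, eigenvectors e) of an unbounded monotone selfadjoint
  operator with compact resolvent: nondecreasing nonnegative eigenvalues tending to infinity,
  complete orthonormal eigenvectors.\<close>
definition spectral_data :: "pt set \<Rightarrow> (nat \<Rightarrow> real) \<Rightarrow> (nat \<Rightarrow> fn) \<Rightarrow> bool" where
  "spectral_data \<Omega> lam e \<longleftrightarrow> mono lam \<and> (\<forall>j. 0 \<le> lam j) \<and> filterlim lam at_top sequentially \<and> ONB \<Omega> e"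

definition spec_dom :: "pt set \<Rightarrow> (nat \<Rightarrow> real) \<Rightarrow> (nat \<Rightarrow> fn) \<Rightarrow> real \<Rightarrow> fn set" where
  "spec_dom \<Omega> lam e s = {v. L2 \<Omega> v \<and> summable (\<lambda>j. (lam j powr s * ip \<Omega> v (e j))^2)}"

definition spec_pow :: "pt set \<Rightarrow> (nat \<Rightarrow> real) \<Rightarrow> (nat \<Rightarrow> fn) \<Rightarrow> real \<Rightarrow> fn \<Rightarrow> fn" where
  "spec_pow \<Omega> lam e s v = (SOME w. L2 \<Omega> w \<and>
     (\<lambda>n. nrm \<Omega> (\<lambda>x. w x - (\<Sum>j<n. lam j powr s * ip \<Omega> v (e j) * e j x))) \<longlonglongrightarrow> 0)"

definition ker_proj :: "pt set \<Rightarrow> (nat \<Rightarrow> real) \<Rightarrow> (nat \<Rightarrow> fn) \<Rightarrow> fn \<Rightarrow> fn" where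
  "ker_proj \<Omega> lam e v = (\<lambda>x. \<Sum>j\<in>{j. lam j = 0}. ip \<Omega> v (e j) * e j x)"

text \<open>int_Omega betahat(v), equal to +infinity when betahat(v) is not in L1.\<close>
definition int_beta :: "pt set \<Rightarrow> (real \<Rightarrow> ennreal) \<Rightarrow> fn \<Rightarrow> ennreal" where
  "int_beta \<Omega> \<beta> v = (\<integral>\<^sup>+x. \<beta> (v x) \<partial>lebesgue_on \<Omega>)"

text \<open>L2(0,T;H), identified with L2((0,T) x Omega).\<close>
definition L2T :: "pt set \<Rightarrow> real \<Rightarrow> (real \<Rightarrow> fn) \<Rightarrow> bool" where
  "L2T \<Omega> T f \<longleftrightarrow> (\<lambda>(t,x). f t x) \<in> borel_measurable (lebesgue_on ({0<..<T} \<times> \<Omega>)) \<and>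
     integrable (lebesgue_on ({0<..<T} \<times> \<Omega>)) (\<lambda>(t,x). (f t x)^2)"

definition L2T_norm :: "pt set \<Rightarrow> real \<Rightarrow> (real \<Rightarrow> fn) \<Rightarrow> real" where
  "L2T_norm \<Omega> T f = sqrt (\<integral>(t,x). (f t x)^2 \<partial>lebesgue_on ({0<..<T} \<times> \<Omega>))"

definition L2T_dom :: "pt set \<Rightarrow> real \<Rightarrow> (nat \<Rightarrow> real) \<Rightarrow> (nat \<Rightarrow> fn) \<Rightarrow> real \<Rightarrow> (real \<Rightarrow> fn) \<Rightarrow> bool" where
  "L2T_dom \<Omega> T lam e s \<mu> \<longleftrightarrow> L2T \<Omega> T \<mu> \<and>
     (AE t in lebesgue_on {0<..<T}. \<mu> t \<in> spec_dom \<Omega> lam e s) \<and>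
     integrable (lebesgue_on {0<..<T}) (\<lambda>t. (nrm \<Omega> (spec_pow \<Omega> lam e s (\<mu> t)))^2)"

text \<open>phi in H1(0,T;H) with time derivative psi in L2(0,T;H); phi is the continuous
  representative, phi(t) = phi(0) + int_0^t psi(s) ds for every t in [0,T].\<close>
definition has_time_deriv :: "pt set \<Rightarrow> real \<Rightarrow> (real \<Rightarrow> fn) \<Rightarrow> (real \<Rightarrow> fn) \<Rightarrow> bool" where
  "has_time_deriv \<Omega> T \<phi> \<psi> \<longleftrightarrow> L2T \<Omega> T \<phi> \<and> L2T \<Omega> T \<psi> \<and> L2 \<Omega> (\<phi> 0) \<and>
     (AE x in lebesgue_on \<Omega>. set_integrable lborel {0..T} (\<lambda>s. \<psi> s x)) \<and>
     (\<forall>t\<in>{0..T}. AE x in lebesgue_on \<Omega>. \<phi> t x = \<phi> 0 x + (LINT s:{0..t}|lborel. \<psi> s x))"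

definition convex_ennreal :: "(real \<Rightarrow> ennreal) \<Rightarrow> bool" where
  "convex_ennreal \<beta> \<longleftrightarrow> (\<forall>x y a. 0 \<le> a \<and> a \<le> 1 \<longrightarrow>
      \<beta> (a * x + (1 - a) * y) \<le> ennreal a * \<beta> x + ennreal (1 - a) * \<beta> y)"

definition lsc_ennreal :: "(real \<Rightarrow> ennreal) \<Rightarrow> bool" where
  "lsc_ennreal \<beta> \<longleftrightarrow> (\<forall>c. closed {x. \<beta> x \<le> c})"

text \<open>Standing assumptions of the paper (A with data lam,e; B with data lam',e').\<close>
definition setting :: "pt set \<Rightarrow> (nat \<Rightarrow> real) \<Rightarrow> (nat \<Rightarrow> fn) \<Rightarrow> (nat \<Rightarrow> real) \<Rightarrow> (nat \<Rightarrow> fn) \<Rightarrow>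
    real \<Rightarrow> real \<Rightarrow> real \<Rightarrow> (real \<Rightarrow> ennreal) \<Rightarrow> (real \<Rightarrow> real) \<Rightarrow> (real \<Rightarrow> real) \<Rightarrow> real \<Rightarrow> bool" where
  "setting \<Omega> lam e lam' e' r \<sigma>0 \<tau> \<beta> \<pi>h \<pi> L \<longleftrightarrow>
     open \<Omega> \<and> bounded \<Omega> \<and> connected \<Omega> \<and>
     spectral_data \<Omega> lam e \<and> spectral_data \<Omega> lam' e' \<and>
     0 < r \<and> 0 < \<sigma>0 \<and> 0 < \<tau> \<and>
     (0 < lam 0 \<or> (0 = lam 0 \<and> lam 0 < lam 1 \<and> (\<exists>c. AE x in lebesgue_on \<Omega>. e 0 x = c))) \<and>
     (lam 0 = 0 \<longrightarrow> (\<forall>\<sigma>\<in>{0<..<\<sigma>0}. \<forall>c. (\<lambda>x. c) \<in> spec_dom \<Omega> lam' e' \<sigma>)) \<and>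
     convex_ennreal \<beta> \<and> lsc_ennreal \<beta> \<and> \<beta> 0 = 0 \<and>
     (\<forall>s. (\<pi>h has_real_derivative \<pi> s) (at s)) \<and>
     0 \<le> L \<and> (\<forall>a b. \<bar>\<pi> a - \<pi> b\<bar> \<le> L * \<bar>a - b\<bar>) \<and>
     Liminf at_infinity (\<lambda>s. (enn2ereal (\<beta> s) + ereal (\<pi>h s)) / ereal (s^2)) > 0"

definition limiting_solution :: "pt set \<Rightarrow> (nat \<Rightarrow> real) \<Rightarrow> (nat \<Rightarrow> fn) \<Rightarrow> (nat \<Rightarrow> real) \<Rightarrow> (nat \<Rightarrow> fn) \<Rightarrow>
    real \<Rightarrow> real \<Rightarrow> real \<Rightarrow> (real \<Rightarrow> ennreal) \<Rightarrow> (real \<Rightarrow> real) \<Rightarrow> fn \<Rightarrow> (real \<Rightarrow> fn) \<Rightarrow>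
    (real \<Rightarrow> fn) \<Rightarrow> (real \<Rightarrow> fn) \<Rightarrow> (real \<Rightarrow> fn) \<Rightarrow> bool" where
  "limiting_solution \<Omega> lam e lam' e' r \<tau> T \<beta> \<pi> \<phi>0 f \<phi> \<psi> \<mu> \<longleftrightarrow>
     has_time_deriv \<Omega> T \<phi> \<psi> \<and> L2T_dom \<Omega> T lam e (2 * r) \<mu> \<and>
     (AE t in lebesgue_on {0<..<T}. \<forall>v \<in> spec_dom \<Omega> lam e r.
        ip \<Omega> (\<psi> t) v + ip \<Omega> (spec_pow \<Omega> lam e r (\<mu> t)) (spec_pow \<Omega> lam e r v) = 0) \<and>
     (AE t in lebesgue_on {0<..<T}. \<forall>v. L2 \<Omega> v \<longrightarrow>
        ereal (\<tau> * ip \<Omega> (\<psi> t) (\<lambda>x. \<phi> t x - v x)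
               + ip \<Omega> (\<lambda>x. \<phi> t x - ker_proj \<Omega> lam' e' (\<phi> t) x) (\<lambda>x. \<phi> t x - v x))
        + enn2ereal (int_beta \<Omega> \<beta> (\<phi> t))
        + ereal (ip \<Omega> (\<lambda>x. \<pi> (\<phi> t x) - f t x) (\<lambda>x. \<phi> t x - v x))
        \<le> ereal (ip \<Omega> (\<mu> t) (\<lambda>x. \<phi> t x - v x)) + enn2ereal (int_beta \<Omega> \<beta> v)) \<and>
     (AE x in lebesgue_on \<Omega>. \<phi> 0 x = \<phi>0 x)"

end

theory Submission
  imports Defs
begin

text \<open>Write \<open>\<phi>, \<psi>, \<mu>, f\<close> for the differences of the two solutions and of the data. Testing each variational
  inequality with the other solution and adding gives, for almost every time,
  \<open>\<tau> (\<psi>, \<phi>) \<le> (\<mu>, \<phi>) + (f, \<phi>) + L \<parallel>\<phi>\<parallel>\<^sup>2\<close>, because \<open>I - P\<close> is monotone and the convex integrals cancel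
  (they are finite, as testing with \<open>0\<close> shows). In the eigenbasis of \<open>A\<close> the evolution equation reads
  \<open>\<phi>\<^sub>j' = \<psi>\<^sub>j = - \<lambda>\<^sub>j\<^sup>2\<^sup>r \<mu>\<^sub>j\<close> with \<open>\<phi>\<^sub>j(0) = 0\<close>, so summing over \<open>j\<close> by Parseval's identity yields
  \<open>\<integral>\<^sub>0\<^sup>t (\<psi>, \<phi>) = \<parallel>\<phi>(t)\<parallel>\<^sup>2 / 2\<close> and \<open>\<integral>\<^sub>0\<^sup>t (\<mu>, \<phi>) \<le> 0\<close>. Gronwall's lemma then gives the claim with
  \<open>C\<^sup>2 = exp ((2 L + 1) T / \<tau>) / \<tau>\<close>. The completeness of \<open>L\<^sup>2\<close> (Riesz-Fischer) enters only to know that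
  \<^const>\<open>spec_pow\<close> chooses an existing function.\<close>

text \<open>No calculus of H-valued functions is set up: after projection on an eigenvector every
  quantity is a real function of time, and only the scalar identity for a density times its own
  indefinite integral is needed. This also avoids applying powers of A to the difference \<phi>,
  which is only known to take values in H. Two obstacles shape the rest. \<open>L2T\<close> lives on
  the completed product measure, so Fubini is applied to Borel representatives. And \<phi> obeys its
  integral formula at every time but is only Lebesgue measurable on the cylinder, so it is kept next
  to a representative \<Phi> that agrees with it for almost every time: estimates integrate \<Phi>,
  while the conclusion concerns \<phi> and holds at every time. In the constant,
  \<open>2 * L\<close> comes from the Lipschitz perturbation, \<open>1\<close> from splitting 2(f,
  \<phi>) by Young's inequality, and the two divisions by \<tau> from the factor in front of the
  time derivative.\<close>

subsection \<open>Orthonormal expansions in \<open>L\<^sup>2\<close>\<close>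

lemma abs_mult_le_sum_squares: "\<bar>a * b\<bar> \<le> a\<^sup>2 + b\<^sup>2" for a b :: real
proof -
  have "2 * \<bar>a * b\<bar> \<le> a\<^sup>2 + b\<^sup>2"
    using sum_squares_bound[of "\<bar>a\<bar>" "\<bar>b\<bar>"] by (simp add: abs_mult)
  then show ?thesis by linarith
qed

lemma L2_mult_integrable:
  assumes "L2 \<Omega> v" "L2 \<Omega> w"
  shows "integrable (lebesgue_on \<Omega>) (\<lambda>x. v x * w x)"
proof (rule Bochner_Integration.integrable_bound)
  show "integrable (lebesgue_on \<Omega>) (\<lambda>x. (v x)\<^sup>2 + (w x)\<^sup>2)"
    using assms by (auto simp: L2_def)
  show "(\<lambda>x. v x * w x) \<in> borel_measurable (lebesgue_on \<Omega>)"
    using assms by (auto simp: L2_def)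
  show "AE x in lebesgue_on \<Omega>. norm (v x * w x) \<le> norm ((v x)\<^sup>2 + (w x)\<^sup>2)"
    using abs_mult_le_sum_squares by simp
qed

lemma L2_add: "L2 \<Omega> v \<Longrightarrow> L2 \<Omega> w \<Longrightarrow> L2 \<Omega> (\<lambda>x. v x + w x)"
  using L2_mult_integrable[of \<Omega> v w]
  by (auto simp: L2_def power2_sum mult.assoc)

lemma L2_scale: "L2 \<Omega> v \<Longrightarrow> L2 \<Omega> (\<lambda>x. c * v x)"
  by (auto simp: L2_def power_mult_distrib)

lemma L2_diff: "L2 \<Omega> v \<Longrightarrow> L2 \<Omega> w \<Longrightarrow> L2 \<Omega> (\<lambda>x. v x - w x)"
  using L2_add[of \<Omega> v "\<lambda>x. (-1) * w x"] L2_scale[of \<Omega> w "-1"] by simp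

lemma L2_zero: "L2 \<Omega> (\<lambda>x. 0)"
  by (auto simp: L2_def)

lemma L2_sum: "(\<And>j. j \<in> I \<Longrightarrow> L2 \<Omega> (v j)) \<Longrightarrow> L2 \<Omega> (\<lambda>x. \<Sum>j\<in>I. v j x)"
  by (induction I rule: infinite_finite_induct) (auto simp: L2_zero L2_add)

lemma L2_lincomb: "(\<And>j. L2 \<Omega> (e j)) \<Longrightarrow> L2 \<Omega> (\<lambda>x. \<Sum>j\<in>I. a j * e j x)"
  by (intro L2_sum L2_scale)

lemma ip_commute: "ip \<Omega> v w = ip \<Omega> w v"
  by (simp add: ip_def mult.commute)

lemma ip_add_left: "L2 \<Omega> u \<Longrightarrow> L2 \<Omega> v \<Longrightarrow> L2 \<Omega> w \<Longrightarrow> ip \<Omega> (\<lambda>x. u x + v x) w = ip \<Omega> u w + ip \<Omega> v w"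
  by (simp add: ip_def distrib_right L2_mult_integrable)

lemma ip_diff_left: "L2 \<Omega> u \<Longrightarrow> L2 \<Omega> v \<Longrightarrow> L2 \<Omega> w \<Longrightarrow> ip \<Omega> (\<lambda>x. u x - v x) w = ip \<Omega> u w - ip \<Omega> v w"
  by (simp add: ip_def left_diff_distrib L2_mult_integrable)

lemma ip_scale_left: "ip \<Omega> (\<lambda>x. c * v x) w = c * ip \<Omega> v w"
  by (simp add: ip_def mult.assoc)

lemma ip_add_right: "L2 \<Omega> u \<Longrightarrow> L2 \<Omega> v \<Longrightarrow> L2 \<Omega> w \<Longrightarrow> ip \<Omega> w (\<lambda>x. u x + v x) = ip \<Omega> w u + ip \<Omega> w v"
  by (metis ip_commute ip_add_left)

lemma ip_diff_right: "L2 \<Omega> u \<Longrightarrow> L2 \<Omega> v \<Longrightarrow> L2 \<Omega> w \<Longrightarrow> ip \<Omega> w (\<lambda>x. u x - v x) = ip \<Omega> w u - ip \<Omega> w v"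
  by (metis ip_commute ip_diff_left)

lemma ip_lincomb_left:
  assumes "\<And>j. L2 \<Omega> (e j)" "L2 \<Omega> w"
  shows "ip \<Omega> (\<lambda>x. \<Sum>j\<in>I. a j * e j x) w = (\<Sum>j\<in>I. a j * ip \<Omega> (e j) w)"
proof (induction I rule: infinite_finite_induct)
  case (insert j I)
  then show ?case
    by (simp add: ip_add_left L2_scale L2_lincomb assms ip_scale_left)
qed (auto simp: ip_def)

lemma ip_lincomb_right:
  assumes "\<And>j. L2 \<Omega> (e j)" "L2 \<Omega> w"
  shows "ip \<Omega> w (\<lambda>x. \<Sum>j\<in>I. a j * e j x) = (\<Sum>j\<in>I. a j * ip \<Omega> w (e j))"
  using ip_lincomb_left[OF assms] by (simp add: ip_commute)

lemma ip_self_nonneg: "0 \<le> ip \<Omega> v v"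
  by (simp add: ip_def)

lemma nrm_square: "(nrm \<Omega> v)\<^sup>2 = ip \<Omega> v v"
  by (simp add: nrm_def ip_self_nonneg)

lemma nrm_nonneg: "0 \<le> nrm \<Omega> v"
  by (simp add: nrm_def ip_self_nonneg)

text \<open>Nonnegativity of the squared norms of v + w and v - w. In \<open>energy_estimate\<close>
  this splits the forcing term.\<close>

lemma ip_double_le:
  assumes "L2 \<Omega> v" "L2 \<Omega> w"
  shows "2 * \<bar>ip \<Omega> v w\<bar> \<le> ip \<Omega> v v + ip \<Omega> w w"
proof -
  have "0 \<le> ip \<Omega> (\<lambda>x. v x + w x) (\<lambda>x. v x + w x)" "0 \<le> ip \<Omega> (\<lambda>x. v x - w x) (\<lambda>x. v x - w x)"
    by (rule ip_self_nonneg)+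
  with assms show ?thesis
    by (simp add: ip_add_left ip_add_right ip_diff_left ip_diff_right L2_add L2_diff ip_commute[of \<Omega> w v])
qed

text \<open>The quadratic polynomial s -> |v - s w|^2 is nonnegative for all real s.\<close>

lemma ip_Cauchy_Schwarz:
  assumes "L2 \<Omega> v" "L2 \<Omega> w"
  shows "(ip \<Omega> v w)\<^sup>2 \<le> ip \<Omega> v v * ip \<Omega> w w"
proof -
  define a b c where "a = ip \<Omega> v v" and "b = ip \<Omega> v w" and "c = ip \<Omega> w w"
  have q: "0 \<le> a - 2 * s * b + s\<^sup>2 * c" for s
  proof -
    have "0 \<le> ip \<Omega> (\<lambda>x. v x - s * w x) (\<lambda>x. v x - s * w x)"
      by (rule ip_self_nonneg)
    also have "\<dots> = a - s * b - s * (b - s * c)"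
      using assms
      by (simp add: ip_diff_left ip_diff_right L2_diff L2_scale ip_scale_left
          ip_commute[of \<Omega> _ "\<lambda>x. s * w x"] ip_commute[of \<Omega> w v] a_def b_def c_def right_diff_distrib)
    finally show ?thesis by (simp add: algebra_simps power2_eq_square)
  qed
  have "0 \<le> a" "0 \<le> c" by (simp_all add: a_def c_def ip_self_nonneg)
  show ?thesis
  proof (cases "c = 0")
    case True
    have "b = 0"
    proof (rule ccontr)
      assume "b \<noteq> 0"
      \<comment> \<open>For \<open>c = 0\<close> the polynomial is affine in s, and this s gives it
        the value -1.\<close>
      then show False using q[of "(a + 1) / (2 * b)"] True by simp
    qed
    then show ?thesis using \<open>0 \<le> a\<close> \<open>0 \<le> c\<close> by (simp flip: a_def b_def c_def)
  next
    case False
    then have "0 < c" using \<open>0 \<le> c\<close> by simp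
    \<comment> \<open>The minimiser of the polynomial.\<close>
    then show ?thesis using q[of "b / c"]
      by (simp add: power_divide field_simps power2_eq_square flip: a_def b_def c_def)
  qed
qed

text \<open>Lebesgue measure is complete, so measurability of \<open>w\<close> follows and does not
  have to be assumed.\<close>

lemma L2_cong_AE:
  assumes "L2 \<Omega> v" "AE x in lebesgue_on \<Omega>. v x = w x" "\<Omega> \<in> sets lebesgue"
  shows "L2 \<Omega> w"
proof -
  have m: "w \<in> borel_measurable (lebesgue_on \<Omega>)"
  proof -
    have v: "(\<lambda>x. indicator \<Omega> x *\<^sub>R v x) \<in> borel_measurable lebesgue"
      using assms by (subst borel_measurable_restrict_space_iff[symmetric]) (auto simp: L2_def)
    have "AE x in lebesgue. indicator \<Omega> x *\<^sub>R v x = indicator \<Omega> x *\<^sub>R w x"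
      using assms(2,3) by (subst (asm) AE_restrict_space_iff) (auto elim!: eventually_mono simp: indicator_def)
    from borel_measurable_AE[OF v this]
    have "(\<lambda>x. indicator \<Omega> x *\<^sub>R w x) \<in> borel_measurable lebesgue" .
    then show ?thesis
      using assms(3) by (subst borel_measurable_restrict_space_iff) auto
  qed
  have "integrable (lebesgue_on \<Omega>) (\<lambda>x. (w x)\<^sup>2)"
    using assms(1,2) m
    by (subst integrable_cong_AE[where g="\<lambda>x. (v x)\<^sup>2"]) (auto simp: L2_def elim!: eventually_mono)
  with m show ?thesis by (simp add: L2_def)
qed

lemma ip_cong_AE:
  assumes "L2 \<Omega> v" "L2 \<Omega> v'" "L2 \<Omega> w" "L2 \<Omega> w'"
    and "AE x in lebesgue_on \<Omega>. v x = v' x" "AE x in lebesgue_on \<Omega>. w x = w' x"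
  shows "ip \<Omega> v w = ip \<Omega> v' w'"
  unfolding ip_def using assms
  by (intro integral_cong_AE) (auto simp: L2_def)

lemma ONB_L2: "ONB \<Omega> e \<Longrightarrow> L2 \<Omega> (e j)"
  and ONB_ip: "ONB \<Omega> e \<Longrightarrow> ip \<Omega> (e i) (e j) = (if i = j then 1 else 0)"
  by (auto simp: ONB_def)

lemma ip_lincomb_basis:
  assumes "ONB \<Omega> e" "finite I"
  shows "ip \<Omega> (\<lambda>x. \<Sum>j\<in>I. a j * e j x) (e k) = (if k \<in> I then a k else 0)"
  using assms by (simp add: ip_lincomb_left ONB_L2 ONB_ip if_distrib cong: if_cong)

lemma ip_lincomb_self:
  assumes "ONB \<Omega> e" "finite I"
  shows "ip \<Omega> (\<lambda>x. \<Sum>j\<in>I. a j * e j x) (\<lambda>x. \<Sum>j\<in>I. a j * e j x) = (\<Sum>j\<in>I. (a j)\<^sup>2)"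
  using assms
  by (simp add: ip_lincomb_right[where w="\<lambda>x. \<Sum>j\<in>I. a j * e j x"] ONB_L2 L2_lincomb ip_lincomb_basis power2_eq_square)

lemma ip_minus_projection_self:
  assumes "ONB \<Omega> e" "finite I" "L2 \<Omega> v"
  shows "ip \<Omega> (\<lambda>x. v x - (\<Sum>j\<in>I. ip \<Omega> v (e j) * e j x)) (\<lambda>x. v x - (\<Sum>j\<in>I. ip \<Omega> v (e j) * e j x))
       = ip \<Omega> v v - (\<Sum>j\<in>I. (ip \<Omega> v (e j))\<^sup>2)"
proof -
  let ?P = "\<lambda>x. \<Sum>j\<in>I. ip \<Omega> v (e j) * e j x"
  have P: "L2 \<Omega> ?P" using assms by (intro L2_lincomb ONB_L2)
  have "ip \<Omega> v ?P = (\<Sum>j\<in>I. (ip \<Omega> v (e j))\<^sup>2)"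
    using assms by (simp add: ip_lincomb_right ONB_L2 power2_eq_square)
  moreover have "ip \<Omega> ?P ?P = (\<Sum>j\<in>I. (ip \<Omega> v (e j))\<^sup>2)"
    using assms by (simp add: ip_lincomb_self)
  ultimately show ?thesis
    using assms P by (simp add: ip_diff_left ip_diff_right L2_diff ip_commute[of \<Omega> ?P v])
qed

lemma Bessel_inequality:
  assumes "ONB \<Omega> e" "finite I" "L2 \<Omega> v"
  shows "(\<Sum>j\<in>I. (ip \<Omega> v (e j))\<^sup>2) \<le> ip \<Omega> v v"
  using ip_self_nonneg[of \<Omega> "\<lambda>x. v x - (\<Sum>j\<in>I. ip \<Omega> v (e j) * e j x)"]
    ip_minus_projection_self[OF assms] by simp

text \<open>Completeness in \<open>ONB\<close> is norm convergence of the expansion, and the squared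
  norm of the remainder is |v|^2 minus the partial sum of squared coefficients.\<close>

lemma Parseval_self:
  assumes "ONB \<Omega> e" "L2 \<Omega> v"
  shows "(\<lambda>n. \<Sum>j<n. (ip \<Omega> v (e j))\<^sup>2) \<longlonglongrightarrow> ip \<Omega> v v"
proof -
  have "(\<lambda>n. (nrm \<Omega> (\<lambda>x. v x - (\<Sum>j<n. ip \<Omega> v (e j) * e j x)))\<^sup>2) \<longlonglongrightarrow> 0\<^sup>2"
    using assms by (intro tendsto_power) (auto simp: ONB_def)
  then have "(\<lambda>n. ip \<Omega> v v - (\<Sum>j<n. (ip \<Omega> v (e j))\<^sup>2)) \<longlonglongrightarrow> 0"
    using assms by (simp add: nrm_square ip_minus_projection_self)
  from tendsto_diff[OF tendsto_const[of "ip \<Omega> v v"] this] show ?thesis by simp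
qed

text \<open>Polarization: \<open>Parseval_self\<close> for v, w and v + w.\<close>

lemma Parseval:
  assumes e: "ONB \<Omega> e" and v: "L2 \<Omega> v" and w: "L2 \<Omega> w"
  shows "(\<lambda>n. \<Sum>j<n. ip \<Omega> v (e j) * ip \<Omega> w (e j)) \<longlonglongrightarrow> ip \<Omega> v w"
proof -
  let ?s = "\<lambda>x. v x + w x"
  have "(\<lambda>n. ((\<Sum>j<n. (ip \<Omega> ?s (e j))\<^sup>2) - (\<Sum>j<n. (ip \<Omega> v (e j))\<^sup>2) - (\<Sum>j<n. (ip \<Omega> w (e j))\<^sup>2)) / 2)
      \<longlonglongrightarrow> (ip \<Omega> ?s ?s - ip \<Omega> v v - ip \<Omega> w w) / 2"
    by (intro tendsto_intros Parseval_self e v w L2_add) simp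
  moreover have "(ip \<Omega> ?s ?s - ip \<Omega> v v - ip \<Omega> w w) / 2 = ip \<Omega> v w"
    using v w by (simp add: ip_add_left ip_add_right L2_add ip_commute[of \<Omega> w v])
  moreover have "((\<Sum>j<n. (ip \<Omega> ?s (e j))\<^sup>2) - (\<Sum>j<n. (ip \<Omega> v (e j))\<^sup>2) - (\<Sum>j<n. (ip \<Omega> w (e j))\<^sup>2)) / 2
      = (\<Sum>j<n. ip \<Omega> v (e j) * ip \<Omega> w (e j))" for n
    using v w ONB_L2[OF e]
    by (simp add: ip_add_left power2_sum sum.distrib mult.assoc flip: sum_distrib_left)
  ultimately show ?thesis by simp
qed

text \<open>The bound does not depend on n, which makes it the majorant for dominated convergence in
  \<open>Parseval_time_integral\<close>.\<close>

lemma Parseval_partial_sum_bound: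
  assumes e: "ONB \<Omega> e" and v: "L2 \<Omega> v" and w: "L2 \<Omega> w"
  shows "\<bar>\<Sum>j<n. ip \<Omega> v (e j) * ip \<Omega> w (e j)\<bar> \<le> ip \<Omega> v v + ip \<Omega> w w"
proof -
  have "\<bar>\<Sum>j<n. ip \<Omega> v (e j) * ip \<Omega> w (e j)\<bar> \<le> (\<Sum>j<n. (ip \<Omega> v (e j))\<^sup>2 + (ip \<Omega> w (e j))\<^sup>2)"
    by (rule order_trans[OF sum_abs]) (intro sum_mono abs_mult_le_sum_squares)
  also have "\<dots> \<le> ip \<Omega> v v + ip \<Omega> w w"
    unfolding sum.distrib by (intro add_mono Bessel_inequality e v w) auto
  finally show ?thesis .
qed

lemma ip_tendsto_of_nrm_tendsto:
  assumes "L2 \<Omega> w" "\<And>n. L2 \<Omega> (s n)" "L2 \<Omega> v" "(\<lambda>n. nrm \<Omega> (\<lambda>x. w x - s n x)) \<longlonglongrightarrow> 0"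
  shows "(\<lambda>n. ip \<Omega> (s n) v) \<longlonglongrightarrow> ip \<Omega> w v"
proof -
  have "(\<lambda>n. ip \<Omega> w v - ip \<Omega> (s n) v) \<longlonglongrightarrow> 0"
  proof (rule tendsto_rabs_zero_cancel, rule tendsto_sandwich[OF _ _ tendsto_const])
    show "(\<lambda>n. nrm \<Omega> (\<lambda>x. w x - s n x) * nrm \<Omega> v) \<longlonglongrightarrow> 0"
      using tendsto_mult[OF assms(4) tendsto_const[of "nrm \<Omega> v"]] by simp
    have "\<bar>ip \<Omega> w v - ip \<Omega> (s n) v\<bar> \<le> nrm \<Omega> (\<lambda>x. w x - s n x) * nrm \<Omega> v" for n
    proof (rule power2_le_imp_le)
      show "\<bar>ip \<Omega> w v - ip \<Omega> (s n) v\<bar>\<^sup>2 \<le> (nrm \<Omega> (\<lambda>x. w x - s n x) * nrm \<Omega> v)\<^sup>2"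
        using ip_Cauchy_Schwarz[OF L2_diff[OF assms(1) assms(2)[of n]] assms(3)]
        by (simp add: power_mult_distrib nrm_square ip_diff_left assms)
    qed (simp add: nrm_nonneg)
    then show "\<forall>\<^sub>F n in sequentially. \<bar>ip \<Omega> w v - ip \<Omega> (s n) v\<bar> \<le> nrm \<Omega> (\<lambda>x. w x - s n x) * nrm \<Omega> v"
      by simp
  qed auto
  from tendsto_diff[OF tendsto_const[of "ip \<Omega> w v"] this] show ?thesis by simp
qed

subsection \<open>Riesz-Fischer and spectral powers\<close>

text \<open>Monotone convergence: the sum of the absolute values has a finite integral, hence is
  finite almost everywhere.\<close>

lemma AE_summable_of_summable_integral:
  fixes b :: "nat \<Rightarrow> 'a \<Rightarrow> real"
  assumes "\<And>k. integrable M (b k)" "summable (\<lambda>k. \<integral>x. \<bar>b k x\<bar> \<partial>M)"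
  shows "AE x in M. summable (\<lambda>k. b k x)"
proof -
  have [measurable]: "\<And>k. b k \<in> borel_measurable M" using assms by auto
  have eq: "(\<integral>\<^sup>+x. ennreal \<bar>b k x\<bar> \<partial>M) = ennreal (\<integral>x. \<bar>b k x\<bar> \<partial>M)" for k
    using assms(1)[of k] by (intro nn_integral_eq_integral) auto
  have "(\<integral>\<^sup>+x. (\<Sum>k. ennreal \<bar>b k x\<bar>) \<partial>M) = (\<Sum>k. \<integral>\<^sup>+x. ennreal \<bar>b k x\<bar> \<partial>M)"
    by (rule nn_integral_suminf) auto
  also have "\<dots> = ennreal (\<Sum>k. \<integral>x. \<bar>b k x\<bar> \<partial>M)"
    unfolding eq using assms(2) by (intro suminf_ennreal2) auto
  finally have "(\<integral>\<^sup>+x. (\<Sum>k. ennreal \<bar>b k x\<bar>) \<partial>M) \<noteq> \<infinity>" by simp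
  then have "AE x in M. (\<Sum>k. ennreal \<bar>b k x\<bar>) \<noteq> \<infinity>"
    by (intro nn_integral_noteq_infinite) auto
  then show ?thesis
  proof eventually_elim
    case (elim x)
    then have "summable (\<lambda>k. \<bar>b k x\<bar>)"
      by (intro summable_suminf_not_top) auto
    then show ?case by (rule summable_rabs_cancel)
  qed
qed

text \<open>The partial sums are Cauchy in mean square. A fast subsequence converges almost
  everywhere, and Fatou's lemma carries the Cauchy estimate over to its limit.\<close>

lemma Riesz_Fischer:
  assumes e: "ONB \<Omega> e" and a: "summable (\<lambda>j. (a j)\<^sup>2)" and fin: "finite_measure (lebesgue_on \<Omega>)"
  shows "\<exists>w. L2 \<Omega> w \<and> (\<lambda>n. nrm \<Omega> (\<lambda>x. w x - (\<Sum>j<n. a j * e j x))) \<longlonglongrightarrow> 0"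
proof -
  interpret finite_measure "lebesgue_on \<Omega>" by (rule fin)
  let ?M = "lebesgue_on \<Omega>"
  define S where "S n x = (\<Sum>j<n. a j * e j x)" for n x
  define R where "R n = (\<Sum>j. (a j)\<^sup>2) - (\<Sum>j<n. (a j)\<^sup>2)" for n
  have SL2: "L2 \<Omega> (S n)" for n
    unfolding S_def by (intro L2_lincomb ONB_L2 e)
  have SSL2: "L2 \<Omega> (\<lambda>x. S m x - S n x)" for m n
    by (intro L2_diff SL2)
  have [measurable]: "S n \<in> borel_measurable ?M" for n
    using SL2[of n] by (simp add: L2_def)
  have R0: "R \<longlonglongrightarrow> 0"
    unfolding R_def using tendsto_diff[OF tendsto_const[of "\<Sum>j. (a j)\<^sup>2"] summable_LIMSEQ[OF a]] by simp
  have Rnn: "0 \<le> R n" for n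
    unfolding R_def using sum_le_suminf[OF a, of "{..<n}"] by simp
  have dist_le: "(\<integral>x. (S m x - S n x)\<^sup>2 \<partial>?M) \<le> R n" if "n \<le> m" for m n
  proof -
    have "S m x - S n x = (\<Sum>j\<in>{n..<m}. a j * e j x)" for x
      unfolding S_def using sum_diff_nat_ivl[of 0 n m "\<lambda>j. a j * e j x"] that
      by (simp add: atLeast0LessThan)
    then have "(\<integral>x. (S m x - S n x)\<^sup>2 \<partial>?M) = (\<Sum>j\<in>{n..<m}. (a j)\<^sup>2)"
      using ip_lincomb_self[OF e, of "{n..<m}" a] by (simp add: ip_def power2_eq_square)
    also have "\<dots> = (\<Sum>j<m. (a j)\<^sup>2) - (\<Sum>j<n. (a j)\<^sup>2)"
      using sum_diff_nat_ivl[of 0 n m "\<lambda>j. (a j)\<^sup>2"] that by (simp add: atLeast0LessThan)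
    also have "\<dots> \<le> R n" using Rnn[of m] by (simp add: R_def)
    finally show ?thesis .
  qed
  \<comment> \<open>Valid for either order of the indices: \<open>N\<close> below is chosen only to
    make \<open>R (N k)\<close> small and need not be increasing.\<close>
  have dist_le': "(\<integral>x. (S m x - S n x)\<^sup>2 \<partial>?M) \<le> R n + R m" for m n
  proof (cases "n \<le> m")
    case True then show ?thesis using dist_le[of n m] Rnn[of m] by simp
  next
    case False then show ?thesis using dist_le[of m n] Rnn[of n] by (simp add: power2_commute)
  qed
  \<comment> \<open>The rate 4^-k leaves the geometric bound 2^-k after the weight 2^k that the
    passage from squares to absolute values costs.\<close>
  have "\<forall>k. \<exists>n. R n \<le> (1/4)^k"
  proof
    fix k
    have "\<forall>\<^sub>F n in sequentially. R n < (1/4)^k"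
      using R0 by (rule order_tendstoD) simp
    then show "\<exists>n. R n \<le> (1/4)^k"
      by (meson eventually_happens' less_imp_le sequentially_bot)
  qed
  then obtain N where N: "\<And>k. R (N k) \<le> (1/4)^k" by metis
  define b where "b k x = S (N (Suc k)) x - S (N k) x" for k x
  have b2: "integrable ?M (\<lambda>x. (b k x)\<^sup>2)" "(\<integral>x. (b k x)\<^sup>2 \<partial>?M) \<le> 2 * (1/4)^k" for k
  proof -
    show "integrable ?M (\<lambda>x. (b k x)\<^sup>2)" using SSL2 by (simp add: b_def L2_def)
    have "R (N (Suc k)) \<le> (1/4)^k" using N[of "Suc k"] by (rule order_trans) simp
    then show "(\<integral>x. (b k x)\<^sup>2 \<partial>?M) \<le> 2 * (1/4)^k"
      unfolding b_def using dist_le'[of "N (Suc k)" "N k"] N[of k] by linarith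
  qed
  have bm[measurable]: "b k \<in> borel_measurable ?M" for k unfolding b_def by measurable
  \<comment> \<open>Young's inequality for the factors sqrt(2^-k) and sqrt(2^k) b: it trades the
    square for the absolute value at the price of a constant, which is integrable because the
    measure is finite.\<close>
  have bpt: "\<bar>b k x\<bar> \<le> (1/2)^k + 2^k * (b k x)\<^sup>2" for k x
  proof -
    have "\<bar>((1/2)^k) * (2^k * b k x)\<bar> \<le> (1/2)^k + 2^k * (b k x)\<^sup>2"
      using abs_mult_le_sum_squares[of "sqrt ((1/2)^k)" "sqrt (2^k) * b k x"]
      by (simp add: power_mult_distrib real_sqrt_divide power_one_over flip: real_sqrt_mult)
    then show ?thesis by (simp add: power_one_over)
  qed
  have bint: "integrable ?M (b k)" for k
  proof (rule Bochner_Integration.integrable_bound)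
    show "integrable ?M (\<lambda>x. (1/2)^k + 2^k * (b k x)\<^sup>2)" using b2 by simp
    show "AE x in ?M. norm (b k x) \<le> norm ((1/2)^k + 2^k * (b k x)\<^sup>2)" using bpt by simp
  qed simp
  have b1: "(\<integral>x. \<bar>b k x\<bar> \<partial>?M) \<le> (measure ?M (space ?M) + 2) * (1/2)^k" for k
  proof -
    have "(\<integral>x. \<bar>b k x\<bar> \<partial>?M) \<le> (\<integral>x. (1/2)^k + 2^k * (b k x)\<^sup>2 \<partial>?M)"
      using bint b2 bpt by (intro integral_mono) auto
    also have "\<dots> = (1/2)^k * measure ?M (space ?M) + 2^k * (\<integral>x. (b k x)\<^sup>2 \<partial>?M)"
      using b2 by simp
    also have "\<dots> \<le> (1/2)^k * measure ?M (space ?M) + 2^k * (2 * (1/4)^k)"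
      by (intro add_left_mono mult_left_mono b2) auto
    also have "2^k * (2 * (1/4)^k) = 2 * (1/2::real)^k"
      by (simp add: power_mult_distrib[symmetric] mult.left_commute)
    finally show ?thesis by (simp add: algebra_simps)
  qed
  have "AE x in ?M. summable (\<lambda>k. b k x)"
  proof (rule AE_summable_of_summable_integral[OF bint])
    show "summable (\<lambda>k. \<integral>x. \<bar>b k x\<bar> \<partial>?M)"
    proof (rule summable_comparison_test')
      show "summable (\<lambda>k. (measure ?M (space ?M) + 2) * (1/2)^k)"
        by (intro summable_mult summable_geometric) simp
      show "norm (\<integral>x. \<bar>b k x\<bar> \<partial>?M) \<le> (measure ?M (space ?M) + 2) * (1/2)^k" if "0 \<le> k" for k
        using b1[of k] by simp
    qed
  qed
  then have conv: "AE x in ?M. convergent (\<lambda>k. S (N k) x)"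
  proof eventually_elim
    case (elim x)
    have "(\<lambda>n. S (N 0) x + (\<Sum>k<n. b k x)) = (\<lambda>n. S (N n) x)"
      unfolding b_def using sum_lessThan_telescope[of "\<lambda>k. S (N k) x"] by (simp add: fun_eq_iff)
    moreover have "convergent (\<lambda>n. S (N 0) x + (\<Sum>k<n. b k x))"
      using elim by (simp add: convergent_add convergent_const summable_iff_convergent)
    ultimately show ?case by simp
  qed
  \<comment> \<open>The value of \<open>lim\<close> is arbitrary where the subsequence diverges, but
    the function is measurable and the divergence set is null.\<close>
  define w where "w x = lim (\<lambda>k. S (N k) x)" for x
  have [measurable]: "w \<in> borel_measurable ?M"
    unfolding w_def by (rule borel_measurable_lim_metric) simp
  have Fatou: "(\<integral>\<^sup>+x. ennreal ((w x - S n x)\<^sup>2) \<partial>?M) \<le> ennreal (R n)" for n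
  proof -
    have "(\<integral>\<^sup>+x. ennreal ((w x - S n x)\<^sup>2) \<partial>?M)
        = (\<integral>\<^sup>+x. liminf (\<lambda>k. ennreal ((S (N k) x - S n x)\<^sup>2)) \<partial>?M)"
    proof (rule nn_integral_cong_AE)
      show "AE x in ?M. ennreal ((w x - S n x)\<^sup>2) = liminf (\<lambda>k. ennreal ((S (N k) x - S n x)\<^sup>2))"
        using conv
      proof eventually_elim
        case (elim x)
        then have "(\<lambda>k. S (N k) x) \<longlonglongrightarrow> w x" by (simp add: w_def convergent_LIMSEQ_iff)
        then have "(\<lambda>k. ennreal ((S (N k) x - S n x)\<^sup>2)) \<longlonglongrightarrow> ennreal ((w x - S n x)\<^sup>2)"
          by (intro tendsto_intros) auto
        then show ?case using lim_imp_Liminf sequentially_bot by fastforce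
      qed
    qed
    also have "\<dots> \<le> liminf (\<lambda>k. \<integral>\<^sup>+x. ennreal ((S (N k) x - S n x)\<^sup>2) \<partial>?M)"
      by (rule nn_integral_liminf) simp
    also have "\<dots> \<le> liminf (\<lambda>k. ennreal (R n + (1/4)^k))"
    proof (rule Liminf_mono, rule always_eventually, rule allI)
      fix k
      have "(\<integral>\<^sup>+x. ennreal ((S (N k) x - S n x)\<^sup>2) \<partial>?M) = ennreal (\<integral>x. (S (N k) x - S n x)\<^sup>2 \<partial>?M)"
        using SSL2 by (intro nn_integral_eq_integral) (auto simp: L2_def)
      also have "\<dots> \<le> ennreal (R n + (1/4)^k)"
        using dist_le'[of "N k" n] N[of k] by (intro ennreal_leI) linarith
      finally show "(\<integral>\<^sup>+x. ennreal ((S (N k) x - S n x)\<^sup>2) \<partial>?M) \<le> ennreal (R n + (1/4)^k)" .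
    qed
    also have "liminf (\<lambda>k. ennreal (R n + (1/4)^k)) = ennreal (R n)"
    proof (rule lim_imp_Liminf)
      have "(\<lambda>k. R n + (1/4)^k) \<longlonglongrightarrow> R n + 0"
        by (intro tendsto_intros LIMSEQ_power_zero) simp
      then show "(\<lambda>k. ennreal (R n + (1/4)^k)) \<longlonglongrightarrow> ennreal (R n)"
        by (intro tendsto_ennrealI) simp
    qed simp
    finally show ?thesis .
  qed
  have dL2: "L2 \<Omega> (\<lambda>x. w x - S n x)" for n
    unfolding L2_def
  proof
    show "integrable ?M (\<lambda>x. (w x - S n x)\<^sup>2)"
      using Fatou[of n] by (intro integrableI_nonneg) (auto simp: order_le_less_trans)
  qed simp
  have "L2 \<Omega> w" using L2_add[OF dL2[of 0] SL2[of 0]] by simp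
  moreover have "(\<lambda>n. nrm \<Omega> (\<lambda>x. w x - S n x)) \<longlonglongrightarrow> 0"
  proof (rule tendsto_sandwich[OF _ _ tendsto_const])
    have "ip \<Omega> (\<lambda>x. w x - S n x) (\<lambda>x. w x - S n x) \<le> R n" for n
    proof -
      have "ennreal (\<integral>x. (w x - S n x)\<^sup>2 \<partial>?M) = (\<integral>\<^sup>+x. ennreal ((w x - S n x)\<^sup>2) \<partial>?M)"
        using dL2[of n] by (intro nn_integral_eq_integral[symmetric]) (auto simp: L2_def)
      with Fatou[of n] have "ennreal (\<integral>x. (w x - S n x)\<^sup>2 \<partial>?M) \<le> ennreal (R n)"
        by (simp only:)
      then show ?thesis
        using Rnn[of n] by (simp add: ennreal_le_iff ip_def power2_eq_square del: power2_diff)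
    qed
    then show "\<forall>\<^sub>F n in sequentially. nrm \<Omega> (\<lambda>x. w x - S n x) \<le> sqrt (R n)"
      by (simp add: nrm_def)
    show "(\<lambda>n. sqrt (R n)) \<longlonglongrightarrow> 0"
      using tendsto_real_sqrt[OF R0] by simp
  qed (auto simp: nrm_nonneg)
  ultimately show ?thesis unfolding S_def by blast
qed

text \<open>\<open>spec_pow\<close> chooses among norm limits of the partial sums, and one exists by
  \<open>Riesz_Fischer\<close>. The coefficients do not depend on the choice: inner products pass to
  the limit, and the k-th coefficient of the partial sums is constant for n > k.\<close>

lemma spec_pow_coeff:
  assumes e: "ONB \<Omega> e" and fin: "finite_measure (lebesgue_on \<Omega>)" and v: "v \<in> spec_dom \<Omega> lam e s"
  shows "L2 \<Omega> (spec_pow \<Omega> lam e s v)"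
    and "ip \<Omega> (spec_pow \<Omega> lam e s v) (e k) = lam k powr s * ip \<Omega> v (e k)"
proof -
  let ?a = "\<lambda>j. lam j powr s * ip \<Omega> v (e j)"
  let ?w = "spec_pow \<Omega> lam e s v"
  let ?S = "\<lambda>n x. \<Sum>j<n. ?a j * e j x"
  have "\<exists>w. L2 \<Omega> w \<and> (\<lambda>n. nrm \<Omega> (\<lambda>x. w x - ?S n x)) \<longlonglongrightarrow> 0"
    using v by (intro Riesz_Fischer e fin) (simp add: spec_dom_def)
  from someI_ex[OF this]
  have w: "L2 \<Omega> ?w" "(\<lambda>n. nrm \<Omega> (\<lambda>x. ?w x - ?S n x)) \<longlonglongrightarrow> 0"
    by (simp_all add: spec_pow_def)
  show "L2 \<Omega> ?w" by (rule w)
  have "(\<lambda>n. ip \<Omega> (?S n) (e k)) \<longlonglongrightarrow> ip \<Omega> ?w (e k)"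
    by (intro ip_tendsto_of_nrm_tendsto w L2_lincomb ONB_L2[OF e])
  moreover have "\<forall>\<^sub>F n in sequentially. ip \<Omega> (?S n) (e k) = ?a k"
    using eventually_gt_at_top[of k] by eventually_elim (simp add: ip_lincomb_basis[OF e])
  then have "(\<lambda>n. ip \<Omega> (?S n) (e k)) \<longlonglongrightarrow> ?a k"
    by (rule tendsto_eventually)
  ultimately show "ip \<Omega> ?w (e k) = ?a k"
    using LIMSEQ_unique by blast
qed

lemma basis_in_spec_dom:
  assumes "ONB \<Omega> e"
  shows "e j \<in> spec_dom \<Omega> lam e s"
  using assms
  by (auto simp: spec_dom_def ONB_L2 ONB_ip intro!: summable_finite[of "{j}"] split: if_splits)

text \<open>From some index on the eigenvalues are at least 1, where a larger exponent gives a
  larger power; the finitely many other terms do not affect summability.\<close>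

lemma spec_dom_antimono:
  assumes "spectral_data \<Omega> lam e" "s \<le> s'"
  shows "spec_dom \<Omega> lam e s' \<subseteq> spec_dom \<Omega> lam e s"
proof
  fix v assume v: "v \<in> spec_dom \<Omega> lam e s'"
  have "\<forall>\<^sub>F j in sequentially. 1 \<le> lam j"
    using assms(1) by (auto simp: spectral_data_def filterlim_at_top)
  then have "\<forall>\<^sub>F j in sequentially. norm ((lam j powr s * ip \<Omega> v (e j))\<^sup>2) \<le> (lam j powr s' * ip \<Omega> v (e j))\<^sup>2"
  proof eventually_elim
    case (elim j)
    then have "lam j powr s \<le> lam j powr s'" by (intro powr_mono assms)
    then show ?case by (auto simp: power_mult_distrib intro!: mult_right_mono power_mono)
  qed
  then have "summable (\<lambda>j. (lam j powr s * ip \<Omega> v (e j))\<^sup>2)"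
    by (rule summable_comparison_test_ev) (use v in \<open>simp add: spec_dom_def\<close>)
  with v show "v \<in> spec_dom \<Omega> lam e s" by (simp add: spec_dom_def)
qed

text \<open>The Parseval series has only one nonzero term. This turns the weak evolution equation
  into one scalar equation per eigenvector.\<close>

lemma ip_spec_pow_basis:
  assumes e: "ONB \<Omega> e" and fin: "finite_measure (lebesgue_on \<Omega>)" and v: "v \<in> spec_dom \<Omega> lam e s"
  shows "ip \<Omega> (spec_pow \<Omega> lam e s v) (spec_pow \<Omega> lam e s (e k)) = (lam k powr s)\<^sup>2 * ip \<Omega> v (e k)"
proof -
  note c = spec_pow_coeff[OF e fin]
  note ek = basis_in_spec_dom[OF e, of k lam s]
  let ?f = "\<lambda>j. lam j powr s * ip \<Omega> v (e j) * (lam j powr s * ip \<Omega> (e k) (e j))"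
  have "(\<lambda>n. \<Sum>j<n. ?f j) \<longlonglongrightarrow> ip \<Omega> (spec_pow \<Omega> lam e s v) (spec_pow \<Omega> lam e s (e k))"
    using Parseval[OF e c(1)[OF v] c(1)[OF ek]] by (simp add: c(2)[OF v] c(2)[OF ek])
  moreover have "\<forall>\<^sub>F n in sequentially. (\<Sum>j<n. ?f j) = (lam k powr s)\<^sup>2 * ip \<Omega> v (e k)"
    using eventually_gt_at_top[of k]
  proof eventually_elim
    case (elim n)
    have "(\<Sum>j<n. ?f j) = (\<Sum>j<n. if j = k then (lam k powr s)\<^sup>2 * ip \<Omega> v (e k) else 0)"
      by (intro sum.cong) (auto simp: ONB_ip[OF e] power2_eq_square)
    then show ?case using elim by simp
  qed
  then have "(\<lambda>n. \<Sum>j<n. ?f j) \<longlonglongrightarrow> (lam k powr s)\<^sup>2 * ip \<Omega> v (e k)"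
    by (rule tendsto_eventually)
  ultimately show ?thesis using LIMSEQ_unique by blast
qed

text \<open>Bessel's inequality on the kernel, which is finite dimensional because the eigenvalues
  tend to infinity.\<close>

lemma ip_minus_ker_proj_nonneg:
  assumes sd: "spectral_data \<Omega> lam e" and v: "L2 \<Omega> v"
  shows "0 \<le> ip \<Omega> (\<lambda>x. v x - ker_proj \<Omega> lam e v x) v"
proof -
  have e: "ONB \<Omega> e" using sd by (simp add: spectral_data_def)
  have "\<forall>\<^sub>F j in sequentially. 1 \<le> lam j"
    using sd by (auto simp: spectral_data_def filterlim_at_top)
  then obtain n where n: "\<And>j. n \<le> j \<Longrightarrow> 1 \<le> lam j"
    by (auto simp: eventually_sequentially)
  have "{j. lam j = 0} \<subseteq> {..<n}"
    using n by (smt (verit) lessThan_iff mem_Collect_eq not_le subsetI)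
  then have fin: "finite {j. lam j = 0}"
    using finite_subset by blast
  have "ip \<Omega> (ker_proj \<Omega> lam e v) v = (\<Sum>j\<in>{j. lam j = 0}. (ip \<Omega> v (e j))\<^sup>2)"
    unfolding ker_proj_def by (simp add: ip_lincomb_left ONB_L2[OF e] v power2_eq_square ip_commute[of \<Omega> "e _" v])
  moreover have "L2 \<Omega> (ker_proj \<Omega> lam e v)"
    unfolding ker_proj_def by (intro L2_lincomb ONB_L2 e)
  ultimately show "0 \<le> ip \<Omega> (\<lambda>x. v x - ker_proj \<Omega> lam e v x) v"
    using Bessel_inequality[OF e fin v] by (simp add: ip_diff_left v)
qed

subsection \<open>Scalar integral identities\<close>

lemma integrable_prod_mult:
  fixes g h :: "real \<Rightarrow> real"
  assumes "integrable lborel g" "integrable lborel h"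
  shows "integrable (lborel \<Otimes>\<^sub>M lborel) (\<lambda>(r, s). g r * h s)"
proof (rule lborel_pair.Fubini_integrable)
  show "(\<lambda>(r, s). g r * h s) \<in> borel_measurable (lborel \<Otimes>\<^sub>M lborel)"
    using assms by measurable
  show "integrable lborel (\<lambda>x. \<integral>y. norm (case (x, y) of (r, s) \<Rightarrow> g r * h s) \<partial>lborel)"
    using assms by (simp add: abs_mult)
  show "AE x in lborel. integrable lborel (\<lambda>y. case (x, y) of (r, s) \<Rightarrow> g r * h s)"
    using assms by simp
qed

text \<open>Fubini on the square, split along its diagonal.\<close>
lemma integral_mult_indefinite_integral:
  fixes g :: "real \<Rightarrow> real"
  assumes g: "integrable lborel g"
  shows "(LINT s:{0..t}|lborel. g s * (LINT r:{0..s}|lborel. g r)) = (LINT s:{0..t}|lborel. g s)\<^sup>2 / 2"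
proof -
  define h where "h s = indicator {0..t} s * g s" for s
  have h: "integrable lborel h"
    unfolding h_def using integrable_mult_indicator[OF _ g, of "{0..t}"] by simp
  then have [measurable]: "h \<in> borel_measurable lborel" by auto
  \<comment> \<open>Indicator of the triangle r \<le> s. This triangle contributes the left-hand
    side of the claim, and the complementary one contributes the same after exchanging the
    variables, so each is half of the square.\<close>
  define c where "c r s = (if r \<le> s then 1 else 0 :: real)" for r s :: real
  have [measurable]: "(\<lambda>(r, s). c r s) \<in> borel_measurable (lborel \<Otimes>\<^sub>M lborel)"
    unfolding c_def by measurable
  have P: "integrable (lborel \<Otimes>\<^sub>M lborel) (\<lambda>(r, s). h r * h s)"
    by (rule integrable_prod_mult[OF h h])
  have P1: "integrable (lborel \<Otimes>\<^sub>M lborel) (\<lambda>(r, s). c r s * (h r * h s))"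
    by (rule Bochner_Integration.integrable_bound[OF P]) (auto simp: c_def)
  have P2: "integrable (lborel \<Otimes>\<^sub>M lborel) (\<lambda>(r, s). (1 - c r s) * (h r * h s))"
    by (rule Bochner_Integration.integrable_bound[OF P]) (auto simp: c_def)
  have inner: "(\<integral>r. c r s * h r \<partial>lborel) * h s = indicator {0..t} s *\<^sub>R (g s * (LINT r:{0..s}|lborel. g r))" for s
  proof (cases "s \<in> {0..t}")
    case True
    then have "(\<integral>r. c r s * h r \<partial>lborel) = (LINT r:{0..s}|lborel. g r)"
      unfolding set_lebesgue_integral_def
      by (intro Bochner_Integration.integral_cong) (auto simp: c_def h_def indicator_def)
    with True show ?thesis by (simp add: h_def)
  qed (simp add: h_def)
  have D1: "(\<integral>s. \<integral>r. c r s * (h r * h s) \<partial>lborel \<partial>lborel) = (LINT s:{0..t}|lborel. g s * (LINT r:{0..s}|lborel. g r))"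
    unfolding set_lebesgue_integral_def[of _ _ "\<lambda>s. g s * _ s"] inner[symmetric]
    by (simp add: mult.assoc[symmetric])
  have "(\<integral>s. \<integral>r. (1 - c r s) * (h r * h s) \<partial>lborel \<partial>lborel) = (\<integral>r. \<integral>s. (1 - c r s) * (h r * h s) \<partial>lborel \<partial>lborel)"
    using lborel_pair.Fubini_integral[OF P2] by simp
  also have "\<dots> = (\<integral>r. \<integral>s. c s r * (h s * h r) \<partial>lborel \<partial>lborel)"
  proof (rule Bochner_Integration.integral_cong[OF refl])
    fix r :: real
    have [measurable]: "(\<lambda>s. c s r) \<in> borel_measurable lborel" "(\<lambda>s. c r s) \<in> borel_measurable lborel"
      unfolding c_def by measurable
    show "(\<integral>s. (1 - c r s) * (h r * h s) \<partial>lborel) = (\<integral>s. c s r * (h s * h r) \<partial>lborel)"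
    proof (rule integral_cong_AE)
      \<comment> \<open>The two indicators differ only at s = r, a null set.\<close>
      show "AE s in lborel. (1 - c r s) * (h r * h s) = c s r * (h s * h r)"
        using AE_lborel_singleton[of r] by eventually_elim (auto simp: c_def)
    qed measurable
  qed
  finally have D2: "(\<integral>s. \<integral>r. (1 - c r s) * (h r * h s) \<partial>lborel \<partial>lborel) = (LINT s:{0..t}|lborel. g s * (LINT r:{0..s}|lborel. g r))"
    using D1 by simp
  have "(LINT s:{0..t}|lborel. g s)\<^sup>2 = (\<integral>s. \<integral>r. h r * h s \<partial>lborel \<partial>lborel)"
    by (simp add: set_lebesgue_integral_def h_def power2_eq_square)
  also have "\<dots> = integral\<^sup>L (lborel \<Otimes>\<^sub>M lborel) (\<lambda>(r, s). h r * h s)"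
    using lborel_pair.integral_snd[OF P] by simp
  also have "\<dots> = integral\<^sup>L (lborel \<Otimes>\<^sub>M lborel) (\<lambda>z. (\<lambda>(r, s). c r s * (h r * h s)) z + (\<lambda>(r, s). (1 - c r s) * (h r * h s)) z)"
    by (intro Bochner_Integration.integral_cong) (auto simp: algebra_simps)
  also have "\<dots> = integral\<^sup>L (lborel \<Otimes>\<^sub>M lborel) (\<lambda>(r, s). c r s * (h r * h s)) + integral\<^sup>L (lborel \<Otimes>\<^sub>M lborel) (\<lambda>(r, s). (1 - c r s) * (h r * h s))"
    by (rule Bochner_Integration.integral_add[OF P1 P2])
  also have "\<dots> = 2 * (LINT s:{0..t}|lborel. g s * (LINT r:{0..s}|lborel. g r))"
    using lborel_pair.integral_snd[OF P1] lborel_pair.integral_snd[OF P2] D1 D2 by simp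
  finally show ?thesis by simp
qed

lemma Gronwall_integral:
  fixes y :: "real \<Rightarrow> real"
  assumes cont: "continuous_on {0..T} y" and b: "0 < b"
    and le: "\<And>t. t \<in> {0..T} \<Longrightarrow> y t \<le> a + b * integral {0..t} y" and t: "t \<in> {0..T}"
  shows "y t \<le> a * exp (b * t)"
proof -
  \<comment> \<open>Integrating factor: the derivative of \<open>Z\<close> is a positive factor
    times \<open>y s - (a + b * integral {0..s} y)\<close>, which the hypothesis makes
    nonpositive.\<close>
  define Z where "Z s = exp (- b * s) * (a + b * integral {0..s} y)" for s
  have "Z t \<le> Z 0"
  proof (rule DERIV_nonpos_imp_decreasing_open[of 0 t])
    show "0 \<le> t" using t by simp
    show "continuous_on {0..t} Z"
      unfolding Z_def
      by (intro continuous_intros indefinite_integral_continuous_1 integrable_continuous_real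
          continuous_on_subset[OF cont]) (use t in auto)
    fix s assume s: "0 < s" "s < t"
    have "((\<lambda>x. integral {0..x} y) has_real_derivative y s) (at s within {0..T})"
      using s t by (intro integral_has_real_derivative cont) auto
    then have I: "((\<lambda>x. integral {0..x} y) has_real_derivative y s) (at s)"
      using s t by (subst (asm) at_within_interior) (auto simp: interior_atLeastAtMost_real)
    have "(Z has_real_derivative (exp (- b * s) * b * (y s - (a + b * integral {0..s} y)))) (at s)"
      unfolding Z_def by (rule derivative_eq_intros I refl)+ (simp add: algebra_simps)
    moreover have "exp (- b * s) * b * (y s - (a + b * integral {0..s} y)) \<le> 0"
      using le[of s] s t b by (intro mult_nonneg_nonpos) auto
    ultimately show "\<exists>d. (Z has_real_derivative d) (at s) \<and> d \<le> 0" by blast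
  qed
  then have "exp (- b * t) * (a + b * integral {0..t} y) \<le> a" by (simp add: Z_def)
  then have "exp (b * t) * (exp (- b * t) * (a + b * integral {0..t} y)) \<le> exp (b * t) * a"
    by (intro mult_left_mono) auto
  then have "a + b * integral {0..t} y \<le> exp (b * t) * a"
    by (simp add: mult.assoc[symmetric] flip: exp_add)
  with le[OF t] show ?thesis by (simp add: mult.commute)
qed

subsection \<open>Borel representatives on the space-time cylinder\<close>

lemma AE_lebesgue_on_iff:
  assumes "\<Omega> \<in> sets borel"
  shows "(AE x in lebesgue_on \<Omega>. P x) \<longleftrightarrow> (AE x in lborel. x \<in> \<Omega> \<longrightarrow> P x)"
  using assms by (subst AE_restrict_space_iff) (auto simp: AE_completion_iff)

lemma lebesgue_on_integral_eq_lborel: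
  fixes f :: "'a::euclidean_space \<Rightarrow> real"
  assumes "\<Omega> \<in> sets borel" "f \<in> borel_measurable borel" "\<And>x. x \<notin> \<Omega> \<Longrightarrow> f x = 0"
  shows "integral\<^sup>L (lebesgue_on \<Omega>) f = integral\<^sup>L lborel f"
    and "integrable (lebesgue_on \<Omega>) f \<longleftrightarrow> integrable lborel f"
proof -
  have eq: "(\<lambda>x. indicator \<Omega> x *\<^sub>R f x) = f"
    using assms(3) by (force simp: fun_eq_iff indicator_def)
  show "integral\<^sup>L (lebesgue_on \<Omega>) f = integral\<^sup>L lborel f"
    using assms(1,2) by (subst integral_restrict_space) (auto simp: eq[simplified] integral_completion)
  show "integrable (lebesgue_on \<Omega>) f \<longleftrightarrow> integrable lborel f"
    using assms(1,2) by (subst integrable_restrict_space) (auto simp: eq[simplified] integrable_completion)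
qed

text \<open>The Borel version is multiplied by the indicator once more, so that it vanishes outside
  \<Omega> exactly and integrals over \<Omega> become integrals over the whole space.\<close>

lemma lebesgue_on_ex_borel:
  fixes f :: "'a::euclidean_space \<Rightarrow> real"
  assumes "\<Omega> \<in> sets borel" "f \<in> borel_measurable (lebesgue_on \<Omega>)"
  shows "\<exists>g. g \<in> borel_measurable borel \<and> (\<forall>x. x \<notin> \<Omega> \<longrightarrow> g x = 0) \<and> (AE x in lborel. x \<in> \<Omega> \<longrightarrow> f x = g x)"
proof -
  have "(\<lambda>x. indicator \<Omega> x *\<^sub>R f x) \<in> borel_measurable lebesgue"
    using assms by (subst borel_measurable_restrict_space_iff[symmetric]) auto
  then obtain g where g: "g \<in> borel_measurable lborel" "AE x in lborel. indicator \<Omega> x *\<^sub>R f x = g x"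
    using completion_ex_borel_measurable_real by blast
  have "AE x in lborel. x \<in> \<Omega> \<longrightarrow> f x = indicator \<Omega> x * g x"
    using g(2) by eventually_elim auto
  then show ?thesis
    using g(1) assms(1) by (intro exI[of _ "\<lambda>x. indicator \<Omega> x * g x"]) auto
qed

text \<open>Borel representatives extended by zero: for these Fubini applies on the whole product,
  whereas \<^const>\<open>L2T\<close> uses the completed measure.\<close>
definition borel_L2T :: "pt set \<Rightarrow> real \<Rightarrow> (real \<Rightarrow> fn) \<Rightarrow> bool" where
  "borel_L2T \<Omega> T g \<longleftrightarrow> (\<lambda>(t, x). g t x) \<in> borel_measurable (lborel \<Otimes>\<^sub>M lborel) \<and>
     integrable (lborel \<Otimes>\<^sub>M lborel) (\<lambda>(t, x). (g t x)\<^sup>2) \<and>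
     (\<forall>t x. t \<notin> {0<..<T} \<or> x \<notin> \<Omega> \<longrightarrow> g t x = 0)"

lemma L2T_ex_borel_L2T:
  assumes op: "open \<Omega>" and f: "L2T \<Omega> T f"
  shows "\<exists>g. borel_L2T \<Omega> T g \<and>
     (AE z in lborel \<Otimes>\<^sub>M lborel. z \<in> {0<..<T} \<times> \<Omega> \<longrightarrow> f (fst z) (snd z) = g (fst z) (snd z)) \<and>
     (L2T_norm \<Omega> T f)\<^sup>2 = (\<integral>(t, x). (g t x)\<^sup>2 \<partial>(lborel \<Otimes>\<^sub>M lborel))"
proof -
  let ?D = "{0<..<T} \<times> \<Omega>"
  have D: "?D \<in> sets borel" using op by (intro borel_open open_Times) auto
  obtain g where g: "g \<in> borel_measurable borel" "\<And>z. z \<notin> ?D \<Longrightarrow> g z = 0"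
    "AE z in lborel. z \<in> ?D \<longrightarrow> (case z of (t, x) \<Rightarrow> f t x) = g z"
    using lebesgue_on_ex_borel[OF D] f unfolding L2T_def by blast
  have AE: "AE z in lebesgue_on ?D. (case z of (t, x) \<Rightarrow> (f t x)\<^sup>2) = (g z)\<^sup>2"
    unfolding AE_lebesgue_on_iff[OF D] using g(3) by eventually_elim auto
  have gm: "(\<lambda>z. (g z)\<^sup>2) \<in> borel_measurable (lebesgue_on ?D)"
    using g(1) by (intro borel_measurable_power) (simp add: measurable_completion measurable_restrict_space1)
  have fm: "(\<lambda>z. case z of (t, x) \<Rightarrow> (f t x)\<^sup>2) \<in> borel_measurable (lebesgue_on ?D)"
    using f by (auto simp: L2T_def)
  have "integrable (lebesgue_on ?D) (\<lambda>z. (g z)\<^sup>2)"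
    using f integrable_cong_AE[OF fm gm AE] by (simp add: L2T_def)
  then have int: "integrable (lborel \<Otimes>\<^sub>M lborel) (\<lambda>z. (g z)\<^sup>2)"
    unfolding lborel_prod by (subst (asm) lebesgue_on_integral_eq_lborel[OF D]) (use g in auto)
  have "integral\<^sup>L (lebesgue_on ?D) (\<lambda>(t, x). (f t x)\<^sup>2) = integral\<^sup>L (lebesgue_on ?D) (\<lambda>z. (g z)\<^sup>2)"
    by (rule integral_cong_AE[OF fm gm AE])
  also have "\<dots> = integral\<^sup>L (lborel \<Otimes>\<^sub>M lborel) (\<lambda>z. (g z)\<^sup>2)"
    unfolding lborel_prod by (rule lebesgue_on_integral_eq_lborel[OF D]) (use g in auto)
  finally have eq: "(L2T_norm \<Omega> T f)\<^sup>2 = integral\<^sup>L (lborel \<Otimes>\<^sub>M lborel) (\<lambda>z. (g z)\<^sup>2)"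
    unfolding L2T_norm_def by simp
  show ?thesis
  proof (intro exI[of _ "curry g"] conjI)
    show "borel_L2T \<Omega> T (curry g)"
      unfolding borel_L2T_def using g(1) int g(2) by (auto simp add: lborel_prod case_prod_beta')
    show "AE z in lborel \<Otimes>\<^sub>M lborel. z \<in> ?D \<longrightarrow> f (fst z) (snd z) = curry g (fst z) (snd z)"
      unfolding lborel_prod using g(3) by eventually_elim (auto simp: case_prod_beta)
    show "(L2T_norm \<Omega> T f)\<^sup>2 = (\<integral>(t, x). (curry g t x)\<^sup>2 \<partial>(lborel \<Otimes>\<^sub>M lborel))"
      using eq by (simp add: case_prod_beta')
  qed
qed

lemma borel_L2T_slice_measurable:
  assumes "borel_L2T \<Omega> T p"
  shows "p t \<in> borel_measurable borel" "p t \<in> borel_measurable (lebesgue_on \<Omega>)"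
proof -
  have "(\<lambda>x. (\<lambda>(t, x). p t x) (t, x)) \<in> borel_measurable lborel"
    using assms by (intro measurable_compose[OF measurable_Pair1']) (auto simp: borel_L2T_def)
  then show "p t \<in> borel_measurable borel" by simp
  then show "p t \<in> borel_measurable (lebesgue_on \<Omega>)"
    by (simp add: measurable_completion measurable_restrict_space1)
qed

lemma borel_L2T_mult_integrable:
  assumes p: "borel_L2T \<Omega> T p" and q: "borel_L2T \<Omega> T q"
  shows "integrable (lborel \<Otimes>\<^sub>M lborel) (\<lambda>(t, x). p t x * q t x)"
proof (rule Bochner_Integration.integrable_bound)
  show "integrable (lborel \<Otimes>\<^sub>M lborel) (\<lambda>z. (\<lambda>(t, x). (p t x)\<^sup>2) z + (\<lambda>(t, x). (q t x)\<^sup>2) z)"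
    using p q by (intro Bochner_Integration.integrable_add) (auto simp: borel_L2T_def)
  have [measurable]: "(\<lambda>(t, x). p t x) \<in> borel_measurable (lborel \<Otimes>\<^sub>M lborel)"
    "(\<lambda>(t, x). q t x) \<in> borel_measurable (lborel \<Otimes>\<^sub>M lborel)"
    using p q by (auto simp: borel_L2T_def)
  show "(\<lambda>(t, x). p t x * q t x) \<in> borel_measurable (lborel \<Otimes>\<^sub>M lborel)"
    by measurable
  show "AE z in lborel \<Otimes>\<^sub>M lborel. norm (case z of (t, x) \<Rightarrow> p t x * q t x)
      \<le> norm ((\<lambda>(t, x). (p t x)\<^sup>2) z + (\<lambda>(t, x). (q t x)\<^sup>2) z)"
    using abs_mult_le_sum_squares by (auto simp: case_prod_beta)
qed

lemma borel_L2T_ip_eq: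
  assumes op: "open \<Omega>" and p: "borel_L2T \<Omega> T p" and q: "borel_L2T \<Omega> T q"
  shows "ip \<Omega> (p t) (q t) = (\<integral>x. p t x * q t x \<partial>lborel)"
  unfolding ip_def
  by (rule lebesgue_on_integral_eq_lborel)
    (use op p q borel_L2T_slice_measurable(1)[OF p] borel_L2T_slice_measurable(1)[OF q] in \<open>auto simp: borel_L2T_def\<close>)

lemma borel_L2T_integrable_ip:
  assumes op: "open \<Omega>" and p: "borel_L2T \<Omega> T p" and q: "borel_L2T \<Omega> T q"
  shows "integrable lborel (\<lambda>t. ip \<Omega> (p t) (q t))"
    and "(\<integral>t. ip \<Omega> (p t) (q t) \<partial>lborel) = (\<integral>(t, x). p t x * q t x \<partial>(lborel \<Otimes>\<^sub>M lborel))"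
  unfolding borel_L2T_ip_eq[OF assms]
  using lborel_pair.integrable_fst[OF borel_L2T_mult_integrable[OF p q]]
    lborel_pair.integral_fst[OF borel_L2T_mult_integrable[OF p q]] by auto

lemma borel_L2T_AE_L2:
  assumes op: "open \<Omega>" and p: "borel_L2T \<Omega> T p"
  shows "AE t in lborel. L2 \<Omega> (p t)"
proof -
  have "AE t in lborel. integrable lborel (\<lambda>x. p t x * p t x)"
    using lborel_pair.AE_integrable_fst[OF borel_L2T_mult_integrable[OF p p]] .
  then show ?thesis
  proof eventually_elim
    case (elim t)
    then have "integrable (lebesgue_on \<Omega>) (\<lambda>x. (p t x)\<^sup>2)"
      unfolding power2_eq_square
      by (subst lebesgue_on_integral_eq_lborel)
        (use op p borel_L2T_slice_measurable(1)[OF p] in \<open>auto simp: borel_L2T_def\<close>)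
    with borel_L2T_slice_measurable[OF p] show ?case by (simp add: L2_def)
  qed
qed

text \<open>A fixed vector becomes a function constant in time on (0, T), so that pairings with it
  are covered by the results for two elements of \<open>borel_L2T\<close>.\<close>

lemma L2_ex_borel_L2T:
  assumes op: "open \<Omega>" and v: "L2 \<Omega> v"
  shows "\<exists>w. w \<in> borel_measurable borel \<and> L2 \<Omega> w \<and> (AE x in lebesgue_on \<Omega>. v x = w x) \<and>
     borel_L2T \<Omega> T (\<lambda>t x. indicator {0<..<T} t * w x)"
proof -
  have Om: "\<Omega> \<in> sets borel" using op by simp
  obtain w where w: "w \<in> borel_measurable borel" "\<And>x. x \<notin> \<Omega> \<Longrightarrow> w x = 0"
    "AE x in lborel. x \<in> \<Omega> \<longrightarrow> v x = w x"
    using lebesgue_on_ex_borel[OF Om] v unfolding L2_def by blast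
  have AE: "AE x in lebesgue_on \<Omega>. v x = w x" using w(3) by (simp add: AE_lebesgue_on_iff[OF Om])
  have L2w: "L2 \<Omega> w" using L2_cong_AE[OF v AE] Om by auto
  have "integrable lborel (\<lambda>x. (w x)\<^sup>2)"
    using L2w w by (subst (asm) L2_def, subst (asm) lebesgue_on_integral_eq_lborel[OF Om]) auto
  moreover have "integrable lborel (indicat_real {0<..<T})"
    by (intro integrable_real_indicator emeasure_bounded_finite) auto
  ultimately have "integrable (lborel \<Otimes>\<^sub>M lborel) (\<lambda>(t, x). indicator {0<..<T} t * (w x)\<^sup>2)"
    using w(1)
    by (intro lborel_pair.Fubini_integrable) (auto simp: abs_mult)
  moreover have "(\<lambda>(t, x). (indicator {0<..<T} t * w x)\<^sup>2) = (\<lambda>(t::real, x). indicator {0<..<T} t * (w x)\<^sup>2)"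
    by (auto simp: indicator_def)
  moreover have "(\<lambda>(t, x). indicator {0<..<T} t * w x) \<in> borel_measurable (lborel \<Otimes>\<^sub>M lborel)"
    using w(1) by measurable
  ultimately have "borel_L2T \<Omega> T (\<lambda>t x. indicator {0<..<T} t * w x)"
    using w(2) by (auto simp: borel_L2T_def)
  with w(1) L2w AE show ?thesis by blast
qed

lemma borel_L2T_integrable_ip_const:
  assumes op: "open \<Omega>" and p: "borel_L2T \<Omega> T p" and v: "L2 \<Omega> v"
  shows "integrable lborel (\<lambda>t. ip \<Omega> (p t) v)"
proof -
  obtain w where w: "w \<in> borel_measurable borel" "L2 \<Omega> w" "AE x in lebesgue_on \<Omega>. v x = w x"
    "borel_L2T \<Omega> T (\<lambda>t x. indicator {0<..<T} t * w x)"
    using L2_ex_borel_L2T[OF op v] by blast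
  \<comment> \<open>The cut-off in time is invisible because \<open>p\<close> vanishes outside (0,
    T).\<close>
  have "ip \<Omega> (p t) (\<lambda>x. indicator {0<..<T} t * w x) = ip \<Omega> (p t) v" for t
    unfolding ip_def
  proof (rule integral_cong_AE)
    show "AE x in lebesgue_on \<Omega>. p t x * (indicator {0<..<T} t * w x) = p t x * v x"
      using w(3) by eventually_elim (use p in \<open>auto simp: borel_L2T_def indicator_def\<close>)
  qed (use borel_L2T_slice_measurable[OF p] w v in \<open>auto simp: L2_def\<close>)
  with borel_L2T_integrable_ip(1)[OF op p w(4)] show ?thesis by simp
qed

text \<open>Parseval at almost every time, then dominated convergence with the majorant |p|^2 +
  |q|^2: summation over the eigenvectors commutes with integration in time.\<close>

lemma Parseval_time_integral:
  assumes op: "open \<Omega>" and e: "ONB \<Omega> e" and p: "borel_L2T \<Omega> T p" and q: "borel_L2T \<Omega> T q"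
    and A: "A \<in> sets borel"
  shows "(\<lambda>n. \<Sum>j<n. LINT s:A|lborel. ip \<Omega> (p s) (e j) * ip \<Omega> (q s) (e j))
    \<longlonglongrightarrow> (LINT s:A|lborel. ip \<Omega> (p s) (q s))"
proof -
  let ?c = "\<lambda>j s. ip \<Omega> (p s) (e j) * ip \<Omega> (q s) (e j)"
  let ?w = "\<lambda>s. ip \<Omega> (p s) (p s) + ip \<Omega> (q s) (q s)"
  note L2p = borel_L2T_AE_L2[OF op p] and L2q = borel_L2T_AE_L2[OF op q]
  have [measurable]: "(\<lambda>s. ip \<Omega> (p s) (e j)) \<in> borel_measurable lborel"
    "(\<lambda>s. ip \<Omega> (q s) (e j)) \<in> borel_measurable lborel" for j
    using borel_L2T_integrable_ip_const[OF op p ONB_L2[OF e]] borel_L2T_integrable_ip_const[OF op q ONB_L2[OF e]]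
    by auto
  have [measurable]: "(\<lambda>s. ip \<Omega> (p s) (q s)) \<in> borel_measurable lborel"
    using borel_L2T_integrable_ip(1)[OF op p q] by auto
  have w: "integrable lborel ?w"
    by (intro Bochner_Integration.integrable_add borel_L2T_integrable_ip(1)[OF op p p] borel_L2T_integrable_ip(1)[OF op q q])
  have c: "integrable lborel (?c j)" for j
  proof (rule Bochner_Integration.integrable_bound[OF w])
    show "AE s in lborel. norm (?c j s) \<le> norm (?w s)"
      using L2p L2q
    proof eventually_elim
      case (elim s)
      have "\<bar>?c j s\<bar> \<le> (ip \<Omega> (p s) (e j))\<^sup>2 + (ip \<Omega> (q s) (e j))\<^sup>2"
        by (rule abs_mult_le_sum_squares)
      also have "\<dots> \<le> ?w s"
        using Bessel_inequality[OF e, of "{j}"] elim by (intro add_mono) auto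
      finally show ?case by simp
    qed
  qed simp
  have "(\<lambda>n. \<integral>s. indicator A s * (\<Sum>j<n. ?c j s) \<partial>lborel) \<longlonglongrightarrow> (\<integral>s. indicator A s * ip \<Omega> (p s) (q s) \<partial>lborel)"
  proof (rule integral_dominated_convergence[where w = ?w])
    show "AE s in lborel. (\<lambda>n. indicator A s * (\<Sum>j<n. ?c j s)) \<longlonglongrightarrow> indicator A s * ip \<Omega> (p s) (q s)"
      using L2p L2q by eventually_elim (intro tendsto_intros Parseval e)
    show "AE s in lborel. norm (indicator A s * (\<Sum>j<n. ?c j s)) \<le> ?w s" for n
      using L2p L2q
    proof eventually_elim
      case (elim s)
      from Parseval_partial_sum_bound[OF e this, of n] ip_self_nonneg[of \<Omega> "p s"] ip_self_nonneg[of \<Omega> "q s"]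
      show ?case by (auto simp: indicator_def)
    qed
  qed (use w A in auto)
  moreover have "(\<integral>s. indicator A s * (\<Sum>j<n. ?c j s) \<partial>lborel) = (\<Sum>j<n. LINT s:A|lborel. ?c j s)" for n
    unfolding set_lebesgue_integral_def sum_distrib_left
    using integrable_mult_indicator[OF _ c, of A] A by (subst Bochner_Integration.integral_sum) auto
  ultimately show ?thesis by (simp add: set_lebesgue_integral_def)
qed

section \<open>Time integrals with values in L2\<close>

lemma square_integral_le_nn_integral:
  fixes h :: "real \<Rightarrow> real"
  assumes [measurable]: "h \<in> borel_measurable lborel" and t: "0 \<le> t"
  shows "ennreal ((LINT s:{0..t}|lborel. h s)\<^sup>2) \<le> ennreal t * (\<integral>\<^sup>+s. ennreal ((h s)\<^sup>2) \<partial>lborel)"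
proof -
  have "ennreal \<bar>LINT s:{0..t}|lborel. h s\<bar> \<le> (\<integral>\<^sup>+s. ennreal \<bar>indicator {0..t} s * h s\<bar> \<partial>lborel)"
  proof (cases "integrable lborel (\<lambda>s. indicator {0..t} s * h s)")
    case True
    then have "ennreal \<bar>LINT s:{0..t}|lborel. h s\<bar> \<le> ennreal (\<integral>s. \<bar>indicator {0..t} s * h s\<bar> \<partial>lborel)"
      unfolding set_lebesgue_integral_def by (intro ennreal_leI) (simp add: integral_abs_bound)
    also have "\<dots> = (\<integral>\<^sup>+s. ennreal \<bar>indicator {0..t} s * h s\<bar> \<partial>lborel)"
      using True by (intro nn_integral_eq_integral[symmetric]) auto
    finally show ?thesis .
  next
    \<comment> \<open>The integral of a non-integrable function is 0 by convention, so the bound is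
      trivial.\<close>
    case False
    then show ?thesis by (simp add: set_lebesgue_integral_def not_integrable_integral_eq)
  qed
  also have "\<dots> = (\<integral>\<^sup>+s. indicator {0..t} s * ennreal \<bar>h s\<bar> \<partial>lborel)"
    by (intro nn_integral_cong) (auto simp: indicator_def)
  finally have "ennreal \<bar>LINT s:{0..t}|lborel. h s\<bar> ^ 2 \<le> (\<integral>\<^sup>+s. indicator {0..t} s * ennreal \<bar>h s\<bar> \<partial>lborel)\<^sup>2"
    by (rule power_mono) simp
  also have "\<dots> \<le> (\<integral>\<^sup>+s. (indicator {0..t} s)\<^sup>2 \<partial>lborel) * (\<integral>\<^sup>+s. ennreal \<bar>h s\<bar> ^ 2 \<partial>lborel)"
    by (rule Cauchy_Schwarz_nn_integral) auto
  also have "(\<integral>\<^sup>+s. (indicator {0..t} s)\<^sup>2 \<partial>lborel) = ennreal t"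
  proof -
    have "(\<integral>\<^sup>+s. (indicator {0..t} s)\<^sup>2 \<partial>lborel) = (\<integral>\<^sup>+s. indicator {0..t} s \<partial>lborel)"
      by (intro nn_integral_cong) (auto simp: indicator_def)
    then show ?thesis using t by simp
  qed
  finally show ?thesis by (simp add: ennreal_power)
qed

text \<open>Cauchy-Schwarz in time and Tonelli make the pointwise time integral square integrable;
  Fubini then moves the pairing with \<open>w\<close> under it. Equality almost everywhere in x at
  the given t is all that \<open>has_time_deriv\<close> offers.\<close>

lemma time_integral_L2:
  assumes op: "open \<Omega>" and p: "borel_L2T \<Omega> T p" and t: "0 \<le> t"
    and v: "AE x in lebesgue_on \<Omega>. v x = (LINT s:{0..t}|lborel. p s x)"
  shows "L2 \<Omega> v" and "L2 \<Omega> w \<Longrightarrow> ip \<Omega> v w = (LINT s:{0..t}|lborel. ip \<Omega> (p s) w)"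
proof -
  have Om: "\<Omega> \<in> sets borel" using op by simp
  define P where "P x = (LINT s:{0..t}|lborel. p s x)" for x
  have pm[measurable]: "(\<lambda>(t, x). p t x) \<in> borel_measurable (lborel \<Otimes>\<^sub>M lborel)"
    using p by (simp add: borel_L2T_def)
  have pm'[measurable]: "(\<lambda>(x, t). p t x) \<in> borel_measurable (lborel \<Otimes>\<^sub>M lborel)"
    using measurable_compose[OF measurable_pair_swap' pm] by (simp add: case_prod_beta)
  have Pm[measurable]: "P \<in> borel_measurable borel"
  proof -
    have "(\<lambda>x. \<integral>s. indicator {0..t} s *\<^sub>R p s x \<partial>lborel) \<in> borel_measurable lborel"
      by (rule lborel.borel_measurable_lebesgue_integral) measurable
    then show ?thesis by (simp add: P_def[abs_def] set_lebesgue_integral_def)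
  qed
  have P0: "P x = 0" if "x \<notin> \<Omega>" for x
    using p that by (simp add: P_def set_lebesgue_integral_def borel_L2T_def)
  have "(\<integral>\<^sup>+x. ennreal ((P x)\<^sup>2) \<partial>lborel) \<le> (\<integral>\<^sup>+x. ennreal t * (\<integral>\<^sup>+s. ennreal ((p s x)\<^sup>2) \<partial>lborel) \<partial>lborel)"
  proof (intro nn_integral_mono)
    fix x
    have "(\<lambda>s. (\<lambda>(x, t). p t x) (x, s)) \<in> borel_measurable lborel"
      by (intro measurable_compose[OF measurable_Pair1' pm']) simp
    then show "ennreal ((P x)\<^sup>2) \<le> ennreal t * (\<integral>\<^sup>+s. ennreal ((p s x)\<^sup>2) \<partial>lborel)"
      unfolding P_def using t by (intro square_integral_le_nn_integral) auto
  qed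
  also have "\<dots> = ennreal t * (\<integral>\<^sup>+x. (\<integral>\<^sup>+s. ennreal ((p s x)\<^sup>2) \<partial>lborel) \<partial>lborel)"
    by (intro nn_integral_cmult lborel.borel_measurable_nn_integral) measurable
  also have "(\<integral>\<^sup>+x. (\<integral>\<^sup>+s. ennreal ((p s x)\<^sup>2) \<partial>lborel) \<partial>lborel)
      = (\<integral>\<^sup>+z. ennreal ((\<lambda>(s, x). (p s x)\<^sup>2) z) \<partial>(lborel \<Otimes>\<^sub>M lborel))"
    by (subst lborel_pair.nn_integral_snd[symmetric]) (auto simp: case_prod_beta)
  also have "\<dots> = ennreal (\<integral>z. (\<lambda>(s, x). (p s x)\<^sup>2) z \<partial>(lborel \<Otimes>\<^sub>M lborel))"
    using p by (intro nn_integral_eq_integral) (auto simp: borel_L2T_def)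
  finally have "(\<integral>\<^sup>+x. ennreal ((P x)\<^sup>2) \<partial>lborel) < \<infinity>"
    by (simp add: ennreal_mult_less_top order_le_less_trans)
  then have "integrable lborel (\<lambda>x. (P x)\<^sup>2)"
    by (intro integrableI_nonneg) auto
  then have "integrable (lebesgue_on \<Omega>) (\<lambda>x. (P x)\<^sup>2)"
    by (subst lebesgue_on_integral_eq_lborel[OF Om]) (use P0 in auto)
  then have L2P: "L2 \<Omega> P"
    by (simp add: L2_def measurable_completion measurable_restrict_space1)
  have vP: "AE x in lebesgue_on \<Omega>. P x = v x"
    using v by eventually_elim (simp add: P_def)
  show L2v: "L2 \<Omega> v"
    using L2_cong_AE[OF L2P vP] Om by auto
  assume w: "L2 \<Omega> w"
  obtain w' where w': "w' \<in> borel_measurable borel" "L2 \<Omega> w'" "AE x in lebesgue_on \<Omega>. w x = w' x"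
    "borel_L2T \<Omega> T (\<lambda>t x. indicator {0<..<T} t * w' x)"
    using L2_ex_borel_L2T[OF op w] by blast
  let ?I = "\<lambda>s x. indicator {0..t} s * (p s x * w' x)"
  have pw: "p s x * (indicator {0<..<T} s * w' x) = p s x * w' x" for s x
    using p by (auto simp: borel_L2T_def indicator_def)
  have I: "integrable (lborel \<Otimes>\<^sub>M lborel) (\<lambda>(s, x). ?I s x)"
  proof (rule Bochner_Integration.integrable_bound[OF borel_L2T_mult_integrable[OF p w'(4)]])
    show "(\<lambda>(s, x). ?I s x) \<in> borel_measurable (lborel \<Otimes>\<^sub>M lborel)"
      using w'(1) by measurable
    show "AE z in lborel \<Otimes>\<^sub>M lborel. norm (case z of (s, x) \<Rightarrow> ?I s x)
        \<le> norm (case z of (s, x) \<Rightarrow> p s x * (indicator {0<..<T} s * w' x))"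
      unfolding pw by (auto simp: indicator_def)
  qed
  have ipw: "ip \<Omega> (p s) w = (\<integral>x. p s x * w' x \<partial>lborel)" for s
  proof -
    have "ip \<Omega> (p s) w = (\<integral>x. p s x * w' x \<partial>lebesgue_on \<Omega>)"
      unfolding ip_def
    proof (rule integral_cong_AE)
      show "AE x in lebesgue_on \<Omega>. p s x * w x = p s x * w' x"
        using w'(3) by eventually_elim simp
    qed (use borel_L2T_slice_measurable[OF p] w w' in \<open>auto simp: L2_def\<close>)
    also have "\<dots> = (\<integral>x. p s x * w' x \<partial>lborel)"
      by (rule lebesgue_on_integral_eq_lborel[OF Om])
        (use p w'(1) borel_L2T_slice_measurable[OF p] in \<open>auto simp: borel_L2T_def\<close>)
    finally show ?thesis .
  qed
  have "ip \<Omega> v w = ip \<Omega> P w'"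
    using vP w'(3) by (intro ip_cong_AE L2v L2P w w'(2)) (auto elim: eventually_mono)
  also have "\<dots> = (\<integral>x. P x * w' x \<partial>lborel)"
    unfolding ip_def by (rule lebesgue_on_integral_eq_lborel[OF Om]) (use P0 w'(1) in auto)
  also have "\<dots> = (\<integral>x. \<integral>s. ?I s x \<partial>lborel \<partial>lborel)"
    by (intro Bochner_Integration.integral_cong refl)
      (simp add: P_def set_lebesgue_integral_def mult.assoc flip: integral_mult_left_zero)
  also have "\<dots> = (\<integral>s. \<integral>x. ?I s x \<partial>lborel \<partial>lborel)"
    by (rule lborel_pair.Fubini_integral[OF I])
  also have "\<dots> = (LINT s:{0..t}|lborel. ip \<Omega> (p s) w)"
    by (simp add: set_lebesgue_integral_def ipw)
  finally show "ip \<Omega> v w = (LINT s:{0..t}|lborel. ip \<Omega> (p s) w)" .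
qed

section \<open>Almost everywhere statements on slices\<close>

lemma (in pair_sigma_finite) AE_pair_swap:
  assumes "AE z in M1 \<Otimes>\<^sub>M M2. Q z"
  shows "AE y in M2. AE x in M1. Q (x, y)"
proof -
  interpret Q: pair_sigma_finite M2 M1 ..
  have "AE z in distr (M2 \<Otimes>\<^sub>M M1) (M1 \<Otimes>\<^sub>M M2) (\<lambda>(x, y). (y, x)). Q z"
    using assms by (subst distr_pair_swap[symmetric])
  then have "AE z in M2 \<Otimes>\<^sub>M M1. Q (case z of (x, y) \<Rightarrow> (y, x))"
    by (rule AE_distrD[OF measurable_pair_swap'])
  from Q.AE_pair[OF this] show ?thesis by simp
qed

lemma L2T_diff:
  assumes "L2T \<Omega> T f" "L2T \<Omega> T g"
  shows "L2T \<Omega> T (\<lambda>t x. f t x - g t x)"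
proof -
  let ?M = "lebesgue_on ({0<..<T} \<times> \<Omega>)"
  let ?f = "\<lambda>(t, x). f t x" and ?g = "\<lambda>(t, x). g t x"
  have m: "?f \<in> borel_measurable ?M" "?g \<in> borel_measurable ?M"
    and i: "integrable ?M (\<lambda>z. (?f z)\<^sup>2)" "integrable ?M (\<lambda>z. (?g z)\<^sup>2)"
    using assms by (auto simp: L2T_def case_prod_beta')
  have "(\<lambda>z. ?f z - ?g z) \<in> borel_measurable ?M" using m by (rule borel_measurable_diff)
  moreover have "integrable ?M (\<lambda>z. (?f z - ?g z)\<^sup>2)"
  proof (rule Bochner_Integration.integrable_bound)
    show "integrable ?M (\<lambda>z. 2 * (?f z)\<^sup>2 + 2 * (?g z)\<^sup>2)" using i by simp
    show "(\<lambda>z. (?f z - ?g z)\<^sup>2) \<in> borel_measurable ?M" using m by measurable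
    have "(a - b)\<^sup>2 \<le> 2 * a\<^sup>2 + 2 * b\<^sup>2" for a b :: real
      using zero_le_power2[of "a + b"] by (simp add: power2_sum power2_diff)
    then show "AE z in ?M. norm ((?f z - ?g z)\<^sup>2) \<le> norm (2 * (?f z)\<^sup>2 + 2 * (?g z)\<^sup>2)"
      by (intro always_eventually allI) (simp add: case_prod_beta)
  qed
  ultimately show ?thesis by (simp add: L2T_def case_prod_beta')
qed

text \<open>The first form serves inner products at a fixed time, the second serves time integrals
  at a fixed point.\<close>

lemma AE_slices_eq:
  assumes op: "open \<Omega>"
    and AE: "AE z in lborel \<Otimes>\<^sub>M lborel. z \<in> {0<..<T} \<times> \<Omega> \<longrightarrow> f (fst z) (snd z) = g (fst z) (snd z)"
  shows "AE t in lborel. t \<in> {0<..<T} \<longrightarrow> (AE x in lebesgue_on \<Omega>. f t x = g t x)"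
    and "AE x in lebesgue_on \<Omega>. AE t in lborel. t \<in> {0<..<T} \<longrightarrow> f t x = g t x"
proof -
  have Om: "\<Omega> \<in> sets borel" using op by simp
  show "AE t in lborel. t \<in> {0<..<T} \<longrightarrow> (AE x in lebesgue_on \<Omega>. f t x = g t x)"
    using lborel_pair.AE_pair[OF AE] unfolding AE_lebesgue_on_iff[OF Om] by eventually_elim auto
  show "AE x in lebesgue_on \<Omega>. AE t in lborel. t \<in> {0<..<T} \<longrightarrow> f t x = g t x"
    using lborel_pair.AE_pair_swap[OF AE] unfolding AE_lebesgue_on_iff[OF Om] by eventually_elim auto
qed

lemma L2T_AE_L2:
  assumes op: "open \<Omega>" and f: "L2T \<Omega> T f"
  shows "AE t in lborel. t \<in> {0<..<T} \<longrightarrow> L2 \<Omega> (f t)"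
proof -
  obtain g where g: "borel_L2T \<Omega> T g"
    "AE z in lborel \<Otimes>\<^sub>M lborel. z \<in> {0<..<T} \<times> \<Omega> \<longrightarrow> f (fst z) (snd z) = g (fst z) (snd z)"
    using L2T_ex_borel_L2T[OF op f] by blast
  from AE_slices_eq(1)[OF op g(2)] borel_L2T_AE_L2[OF op g(1)] show ?thesis
  proof eventually_elim
    case (elim t)
    show ?case
    proof
      assume "t \<in> {0<..<T}"
      with elim have "AE x in lebesgue_on \<Omega>. g t x = f t x" by (simp add: eq_commute)
      from L2_cong_AE[OF elim(2) this] op show "L2 \<Omega> (f t)" by auto
    qed
  qed
qed

section \<open>Nonlinear terms and the difference of the variational inequalities\<close>

lemma L2_Lipschitz_comp:
  assumes fin: "finite_measure (lebesgue_on \<Omega>)" and v: "L2 \<Omega> v"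
    and lip: "\<forall>a b. \<bar>\<pi> a - \<pi> b\<bar> \<le> L * \<bar>a - b\<bar>" and L: "0 \<le> L"
  shows "L2 \<Omega> (\<lambda>x. \<pi> (v x))"
proof -
  interpret finite_measure "lebesgue_on \<Omega>" by (rule fin)
  have "L-lipschitz_on UNIV \<pi>"
    using lip L by (auto simp: lipschitz_on_def dist_real_def)
  then have [measurable]: "\<pi> \<in> borel_measurable borel"
    by (intro borel_measurable_continuous_onI lipschitz_on_continuous_on)
  have [measurable]: "v \<in> borel_measurable (lebesgue_on \<Omega>)" and i: "integrable (lebesgue_on \<Omega>) (\<lambda>x. (v x)\<^sup>2)"
    using v by (auto simp: L2_def)
  have "integrable (lebesgue_on \<Omega>) (\<lambda>x. (\<pi> (v x))\<^sup>2)"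
  proof (rule Bochner_Integration.integrable_bound)
    \<comment> \<open>A Lipschitz function grows at most linearly, and constants are integrable
      because the measure is finite.\<close>
    show "integrable (lebesgue_on \<Omega>) (\<lambda>x. 2 * L\<^sup>2 * (v x)\<^sup>2 + 2 * (\<pi> 0)\<^sup>2)" using i by simp
    have "(\<pi> s)\<^sup>2 \<le> 2 * L\<^sup>2 * s\<^sup>2 + 2 * (\<pi> 0)\<^sup>2" for s
    proof -
      have "(\<pi> s - \<pi> 0)\<^sup>2 \<le> (L * s)\<^sup>2"
        using lip[rule_format, of s 0] L by (simp add: abs_le_square_iff[symmetric] abs_mult)
      \<comment> \<open>The right side minus the left side is the square of \<pi>(s) - 2
        \<pi>(0).\<close>
      moreover have "(\<pi> s)\<^sup>2 \<le> 2 * (\<pi> s - \<pi> 0)\<^sup>2 + 2 * (\<pi> 0)\<^sup>2"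
        using zero_le_power2[of "\<pi> s - 2 * \<pi> 0"] by (simp add: power2_diff)
      ultimately show ?thesis by (simp add: power_mult_distrib)
    qed
    then show "AE x in lebesgue_on \<Omega>. norm ((\<pi> (v x))\<^sup>2) \<le> norm (2 * L\<^sup>2 * (v x)\<^sup>2 + 2 * (\<pi> 0)\<^sup>2)"
      by simp
  qed simp
  then show ?thesis by (simp add: L2_def)
qed

lemma ip_Lipschitz_lower_bound:
  assumes v: "L2 \<Omega> v" "L2 \<Omega> w" and pv: "L2 \<Omega> (\<lambda>x. \<pi> (v x))" "L2 \<Omega> (\<lambda>x. \<pi> (w x))"
    and lip: "\<forall>a b. \<bar>\<pi> a - \<pi> b\<bar> \<le> L * \<bar>a - b\<bar>"
  shows "- (L * ip \<Omega> (\<lambda>x. v x - w x) (\<lambda>x. v x - w x))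
    \<le> ip \<Omega> (\<lambda>x. \<pi> (v x) - \<pi> (w x)) (\<lambda>x. v x - w x)"
proof -
  note d = L2_diff[OF v] L2_diff[OF pv]
  have pt: "- (L * ((a - b) * (a - b))) \<le> (\<pi> a - \<pi> b) * (a - b)" for a b
  proof -
    have "\<bar>(\<pi> a - \<pi> b) * (a - b)\<bar> \<le> L * \<bar>a - b\<bar> * \<bar>a - b\<bar>"
      unfolding abs_mult using lip by (intro mult_right_mono) auto
    also have "\<dots> = L * ((a - b) * (a - b))" by (simp add: mult.assoc)
    finally show ?thesis by linarith
  qed
  have "(\<integral>x. - (L * ((v x - w x) * (v x - w x))) \<partial>lebesgue_on \<Omega>)
      \<le> (\<integral>x. (\<pi> (v x) - \<pi> (w x)) * (v x - w x) \<partial>lebesgue_on \<Omega>)"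
    by (intro integral_mono pt L2_mult_integrable[OF d(2,1)] Bochner_Integration.integrable_minus
        integrable_mult_right L2_mult_integrable[OF d(1,1)])
  then show ?thesis by (simp add: ip_def)
qed

lemma ker_proj_diff:
  assumes "ONB \<Omega> e" "L2 \<Omega> v" "L2 \<Omega> w"
  shows "ker_proj \<Omega> lam e (\<lambda>x. v x - w x) x = ker_proj \<Omega> lam e v x - ker_proj \<Omega> lam e w x"
  using assms by (simp add: ker_proj_def ip_diff_left ONB_L2 left_diff_distrib sum_subtractf)

lemma ip_swap_diff_right: "ip \<Omega> u (\<lambda>x. w x - v x) = - ip \<Omega> u (\<lambda>x. v x - w x)"
proof -
  have "ip \<Omega> u (\<lambda>x. w x - v x) = (\<integral>x. - (u x * (v x - w x)) \<partial>lebesgue_on \<Omega>)"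
    unfolding ip_def by (intro Bochner_Integration.integral_cong) (auto simp: algebra_simps)
  then show ?thesis by (simp add: ip_def)
qed

text \<open>Everything happens at one fixed time. The two integrals of \<beta> have to be real
  numbers before the inequalities are added, since infinite values would not cancel.\<close>

lemma variational_inequality_difference:
  assumes fin: "finite_measure (lebesgue_on \<Omega>)" and sd: "spectral_data \<Omega> lam' e'"
    and L: "0 \<le> L" and lip: "\<forall>a b. \<bar>\<pi> a - \<pi> b\<bar> \<le> L * \<bar>a - b\<bar>" and beta0: "\<beta> 0 = 0"
    and L2s: "L2 \<Omega> \<phi>1" "L2 \<Omega> \<phi>2" "L2 \<Omega> \<psi>1" "L2 \<Omega> \<psi>2" "L2 \<Omega> \<mu>1" "L2 \<Omega> \<mu>2" "L2 \<Omega> f1" "L2 \<Omega> f2"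
    and V1: "\<forall>v. L2 \<Omega> v \<longrightarrow>
        ereal (\<tau> * ip \<Omega> \<psi>1 (\<lambda>x. \<phi>1 x - v x)
               + ip \<Omega> (\<lambda>x. \<phi>1 x - ker_proj \<Omega> lam' e' \<phi>1 x) (\<lambda>x. \<phi>1 x - v x))
        + enn2ereal (int_beta \<Omega> \<beta> \<phi>1) + ereal (ip \<Omega> (\<lambda>x. \<pi> (\<phi>1 x) - f1 x) (\<lambda>x. \<phi>1 x - v x))
        \<le> ereal (ip \<Omega> \<mu>1 (\<lambda>x. \<phi>1 x - v x)) + enn2ereal (int_beta \<Omega> \<beta> v)"
    and V2: "\<forall>v. L2 \<Omega> v \<longrightarrow>
        ereal (\<tau> * ip \<Omega> \<psi>2 (\<lambda>x. \<phi>2 x - v x)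
               + ip \<Omega> (\<lambda>x. \<phi>2 x - ker_proj \<Omega> lam' e' \<phi>2 x) (\<lambda>x. \<phi>2 x - v x))
        + enn2ereal (int_beta \<Omega> \<beta> \<phi>2) + ereal (ip \<Omega> (\<lambda>x. \<pi> (\<phi>2 x) - f2 x) (\<lambda>x. \<phi>2 x - v x))
        \<le> ereal (ip \<Omega> \<mu>2 (\<lambda>x. \<phi>2 x - v x)) + enn2ereal (int_beta \<Omega> \<beta> v)"
  defines "d \<equiv> \<lambda>x. \<phi>1 x - \<phi>2 x"
  shows "\<tau> * ip \<Omega> (\<lambda>x. \<psi>1 x - \<psi>2 x) d
    \<le> ip \<Omega> (\<lambda>x. \<mu>1 x - \<mu>2 x) d + ip \<Omega> (\<lambda>x. f1 x - f2 x) d + L * ip \<Omega> d d"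
proof -
  have e: "ONB \<Omega> e'" using sd by (simp add: spectral_data_def)
  \<comment> \<open>For v = 0 the right side is finite, so a nonnegative summand on the left cannot
    be infinite.\<close>
  have ereal_finite: "\<exists>b. B = ereal b" if "ereal a + B + ereal c \<le> ereal m + 0" "0 \<le> B" for a c m B
    using that by (cases B) auto
  have beta_zero: "enn2ereal (int_beta \<Omega> \<beta> (\<lambda>x. 0)) = 0"
    by (simp add: int_beta_def beta0 zero_ennreal.rep_eq)
  obtain b1 where b1: "enn2ereal (int_beta \<Omega> \<beta> \<phi>1) = ereal b1"
    using V1[rule_format, OF L2_zero, unfolded beta_zero] ereal_finite enn2ereal_nonneg by blast
  obtain b2 where b2: "enn2ereal (int_beta \<Omega> \<beta> \<phi>2) = ereal b2"
    using V2[rule_format, OF L2_zero, unfolded beta_zero] ereal_finite enn2ereal_nonneg by blast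
  let ?K = "ker_proj \<Omega> lam' e'"
  have K: "L2 \<Omega> (?K v)" for v
    unfolding ker_proj_def by (intro L2_lincomb ONB_L2 e)
  have pL2: "L2 \<Omega> (\<lambda>x. \<pi> (\<phi>1 x))" "L2 \<Omega> (\<lambda>x. \<pi> (\<phi>2 x))"
    by (intro L2_Lipschitz_comp[OF fin _ lip L] L2s)+
  have dL2: "L2 \<Omega> d" unfolding d_def by (intro L2_diff L2s)
  have I1: "\<tau> * ip \<Omega> \<psi>1 d + ip \<Omega> (\<lambda>x. \<phi>1 x - ?K \<phi>1 x) d + b1 + ip \<Omega> (\<lambda>x. \<pi> (\<phi>1 x) - f1 x) d \<le> ip \<Omega> \<mu>1 d + b2"
    using V1[rule_format, OF L2s(2)] unfolding b1 b2 d_def by simp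
  have I2: "- \<tau> * ip \<Omega> \<psi>2 d - ip \<Omega> (\<lambda>x. \<phi>2 x - ?K \<phi>2 x) d + b2 - ip \<Omega> (\<lambda>x. \<pi> (\<phi>2 x) - f2 x) d \<le> - ip \<Omega> \<mu>2 d + b1"
    using V2[rule_format, OF L2s(1)] unfolding b1 b2 ip_swap_diff_right[of \<Omega> _ \<phi>2 \<phi>1] d_def by simp
  \<comment> \<open>Linearity of the projection turns the difference of the two terms with I - P
    into the quadratic form of I - P at \<open>d\<close>.\<close>
  have "ip \<Omega> (\<lambda>x. d x - ?K d x) d = ip \<Omega> (\<lambda>x. \<phi>1 x - ?K \<phi>1 x) d - ip \<Omega> (\<lambda>x. \<phi>2 x - ?K \<phi>2 x) d"
  proof -
    have "(\<lambda>x. d x - ?K d x) = (\<lambda>x. (\<phi>1 x - ?K \<phi>1 x) - (\<phi>2 x - ?K \<phi>2 x))"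
      unfolding d_def by (simp add: ker_proj_diff[OF e L2s(1,2)] algebra_simps)
    then show ?thesis by (simp add: ip_diff_left L2_diff L2s K dL2)
  qed
  moreover have "0 \<le> ip \<Omega> (\<lambda>x. d x - ?K d x) d"
    by (rule ip_minus_ker_proj_nonneg[OF sd dL2])
  moreover have "- (L * ip \<Omega> d d) \<le> ip \<Omega> (\<lambda>x. \<pi> (\<phi>1 x)) d - ip \<Omega> (\<lambda>x. \<pi> (\<phi>2 x)) d"
    using ip_Lipschitz_lower_bound[OF L2s(1,2) pL2 lip] by (simp add: ip_diff_left pL2 dL2 flip: d_def)
  ultimately show ?thesis
    using I1 I2 by (simp add: ip_diff_left L2s pL2 dL2 right_diff_distrib)
qed

lemma borel_measurable_indefinite_integral:
  fixes g :: "real \<Rightarrow> real"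
  assumes [measurable]: "g \<in> borel_measurable lborel"
  shows "(\<lambda>s. LINT r:{0..s}|lborel. g r) \<in> borel_measurable lborel"
proof -
  have "(\<lambda>s. \<integral>r. (if 0 \<le> r \<and> r \<le> s then g r else 0) \<partial>lborel) \<in> borel_measurable lborel"
    by (rule lborel.borel_measurable_lebesgue_integral) measurable
  moreover have "(\<lambda>s. LINT r:{0..s}|lborel. g r) = (\<lambda>s. \<integral>r. (if 0 \<le> r \<and> r \<le> s then g r else 0) \<partial>lborel)"
    unfolding set_lebesgue_integral_def
    by (intro ext Bochner_Integration.integral_cong) (auto simp: indicator_def)
  ultimately show ?thesis by simp
qed

subsection \<open>Energy estimate\<close>

lemma set_integral_cong_AE_Ioo:
  fixes f g :: "real \<Rightarrow> real"
  assumes [measurable]: "f \<in> borel_measurable lborel" "g \<in> borel_measurable lborel"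
    and AE: "AE s in lborel. s \<in> {0<..<T} \<longrightarrow> f s = g s" and t: "t \<in> {0..T}"
  shows "(LINT s:{0..t}|lborel. f s) = (LINT s:{0..t}|lborel. g s)"
  unfolding set_lebesgue_integral_def
proof (rule integral_cong_AE)
  \<comment> \<open>The hypothesis controls only (0, T), while \<open>{0..t}\<close> contains 0 and
    possibly T.\<close>
  show "AE s in lborel. indicator {0..t} s *\<^sub>R f s = indicator {0..t} s *\<^sub>R g s"
    using AE AE_lborel_singleton[of 0] AE_lborel_singleton[of T]
    by eventually_elim (use t in \<open>auto simp: indicator_def\<close>)
qed measurable

text \<open>Each coefficient of \<phi> is the indefinite integral of the coefficient of \<Psi> and
  starts at 0, so the scalar identity applies to it, and Parseval sums over j. Here \<phi> supplies
  values at each t and \<Phi> supplies measurability in time; they are exchanged for almost every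
  time only.\<close>

lemma energy_identity:
  assumes op: "open \<Omega>" and e: "ONB \<Omega> e"
    and Psi: "borel_L2T \<Omega> T \<Psi>" and Phi: "borel_L2T \<Omega> T \<Phi>"
    and \<phi>: "\<And>t. t \<in> {0..T} \<Longrightarrow> AE x in lebesgue_on \<Omega>. \<phi> t x = (LINT s:{0..t}|lborel. \<Psi> s x)"
    and \<phi>\<Phi>: "AE t in lborel. t \<in> {0<..<T} \<longrightarrow> (AE x in lebesgue_on \<Omega>. \<phi> t x = \<Phi> t x)"
    and t: "t \<in> {0..T}"
  shows coeff_energy_identity:
      "(LINT s:{0..t}|lborel. ip \<Omega> (\<Psi> s) (e j) * ip \<Omega> (\<Phi> s) (e j)) = (ip \<Omega> (\<phi> t) (e j))\<^sup>2 / 2"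
    and total_energy_identity: "ip \<Omega> (\<phi> t) (\<phi> t) = 2 * (LINT s:{0..t}|lborel. ip \<Omega> (\<Psi> s) (\<Phi> s))"
    and AE_coeff_eq: "AE s in lborel. s \<in> {0<..<T} \<longrightarrow> ip \<Omega> (\<Phi> s) (e j) = (LINT r:{0..s}|lborel. ip \<Omega> (\<Psi> r) (e j))"
proof -
  have L2\<phi>: "L2 \<Omega> (\<phi> s)" and u: "ip \<Omega> (\<phi> s) (e j) = (LINT r:{0..s}|lborel. ip \<Omega> (\<Psi> r) (e j))"
    if "s \<in> {0..T}" for s j
    using time_integral_L2[OF op Psi _ \<phi>[OF that]] ONB_L2[OF e] that by auto
  have int: "integrable lborel (\<lambda>s. ip \<Omega> (\<Psi> s) (e j))" "integrable lborel (\<lambda>s. ip \<Omega> (\<Phi> s) (e j))" for j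
    using borel_L2T_integrable_ip_const[OF op Psi ONB_L2[OF e]] borel_L2T_integrable_ip_const[OF op Phi ONB_L2[OF e]]
    by auto
  have [measurable]: "(\<lambda>s. ip \<Omega> (\<Psi> s) (e j)) \<in> borel_measurable lborel" "(\<lambda>s. ip \<Omega> (\<Phi> s) (e j)) \<in> borel_measurable lborel" for j
    using int by auto
  note [measurable] = borel_measurable_indefinite_integral
  show AE: "AE s in lborel. s \<in> {0<..<T} \<longrightarrow> ip \<Omega> (\<Phi> s) (e j) = (LINT r:{0..s}|lborel. ip \<Omega> (\<Psi> r) (e j))" for j
    using \<phi>\<Phi> borel_L2T_AE_L2[OF op Phi]
  proof eventually_elim
    case (elim s)
    show ?case
    proof
      assume s: "s \<in> {0<..<T}"
      then have "ip \<Omega> (\<Phi> s) (e j) = ip \<Omega> (\<phi> s) (e j)"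
        using elim by (intro ip_cong_AE L2\<phi> ONB_L2[OF e]) (auto elim: eventually_mono)
      then show "ip \<Omega> (\<Phi> s) (e j) = (LINT r:{0..s}|lborel. ip \<Omega> (\<Psi> r) (e j))"
        using u[of s j] s by simp
    qed
  qed
  show coeff: "(LINT s:{0..t}|lborel. ip \<Omega> (\<Psi> s) (e j) * ip \<Omega> (\<Phi> s) (e j)) = (ip \<Omega> (\<phi> t) (e j))\<^sup>2 / 2" for j
  proof -
    have "(LINT s:{0..t}|lborel. ip \<Omega> (\<Psi> s) (e j) * ip \<Omega> (\<Phi> s) (e j))
        = (LINT s:{0..t}|lborel. ip \<Omega> (\<Psi> s) (e j) * (LINT r:{0..s}|lborel. ip \<Omega> (\<Psi> r) (e j)))"
    proof (rule set_integral_cong_AE_Ioo[OF _ _ _ t])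
      show "AE s in lborel. s \<in> {0<..<T} \<longrightarrow> ip \<Omega> (\<Psi> s) (e j) * ip \<Omega> (\<Phi> s) (e j)
          = ip \<Omega> (\<Psi> s) (e j) * (LINT r:{0..s}|lborel. ip \<Omega> (\<Psi> r) (e j))"
        using AE[of j] by eventually_elim auto
    qed measurable
    also have "\<dots> = (ip \<Omega> (\<phi> t) (e j))\<^sup>2 / 2"
      using integral_mult_indefinite_integral[OF int(1)] u[OF t] by simp
    finally show ?thesis .
  qed
  have "(\<lambda>n. \<Sum>j<n. (ip \<Omega> (\<phi> t) (e j))\<^sup>2 / 2) \<longlonglongrightarrow> (LINT s:{0..t}|lborel. ip \<Omega> (\<Psi> s) (\<Phi> s))"
    using Parseval_time_integral[OF op e Psi Phi, of "{0..t}"] by (simp add: coeff)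
  moreover have "(\<lambda>n. \<Sum>j<n. (ip \<Omega> (\<phi> t) (e j))\<^sup>2 / 2) \<longlonglongrightarrow> ip \<Omega> (\<phi> t) (\<phi> t) / 2"
    unfolding sum_divide_distrib[symmetric] by (intro tendsto_divide Parseval_self e L2\<phi>[OF t] tendsto_const) simp
  ultimately show "ip \<Omega> (\<phi> t) (\<phi> t) = 2 * (LINT s:{0..t}|lborel. ip \<Omega> (\<Psi> s) (\<Phi> s))"
    by (auto dest: LIMSEQ_unique)
qed

text \<open>This replaces testing the evolution equation, integrated in time, by \<open>\<mu>\<close>: componentwise
  \<open>\<Phi>\<^sub>j' = - c\<^sub>j M\<^sub>j\<close>, so that \<open>c\<^sub>j \<integral> M\<^sub>j \<Phi>\<^sub>j = - \<Phi>\<^sub>j(t)\<^sup>2 / 2\<close>.\<close>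
lemma potential_pairing_nonpos:
  assumes op: "open \<Omega>" and e: "ONB \<Omega> e"
    and Psi: "borel_L2T \<Omega> T \<Psi>" and Phi: "borel_L2T \<Omega> T \<Phi>" and Mu: "borel_L2T \<Omega> T M"
    and \<phi>: "\<And>t. t \<in> {0..T} \<Longrightarrow> AE x in lebesgue_on \<Omega>. \<phi> t x = (LINT s:{0..t}|lborel. \<Psi> s x)"
    and \<phi>\<Phi>: "AE t in lborel. t \<in> {0<..<T} \<longrightarrow> (AE x in lebesgue_on \<Omega>. \<phi> t x = \<Phi> t x)"
    and c: "\<And>j. 0 \<le> c j"
    and eq: "\<And>j. AE t in lborel. t \<in> {0<..<T} \<longrightarrow> ip \<Omega> (\<Psi> t) (e j) + c j * ip \<Omega> (M t) (e j) = 0"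
    and t: "t \<in> {0..T}"
  shows "(LINT s:{0..t}|lborel. ip \<Omega> (M s) (\<Phi> s)) \<le> 0"
proof -
  have [measurable]: "(\<lambda>s. ip \<Omega> (\<Psi> s) (e j)) \<in> borel_measurable lborel"
    "(\<lambda>s. ip \<Omega> (\<Phi> s) (e j)) \<in> borel_measurable lborel"
    "(\<lambda>s. ip \<Omega> (M s) (e j)) \<in> borel_measurable lborel" for j
    using borel_L2T_integrable_ip_const[OF op Psi ONB_L2[OF e]] borel_L2T_integrable_ip_const[OF op Phi ONB_L2[OF e]]
      borel_L2T_integrable_ip_const[OF op Mu ONB_L2[OF e]] by auto
  have coeff: "(LINT s:{0..t}|lborel. ip \<Omega> (\<Psi> s) (e j) * ip \<Omega> (\<Phi> s) (e j)) = (ip \<Omega> (\<phi> t) (e j))\<^sup>2 / 2" for j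
    by (rule coeff_energy_identity[OF op e Psi Phi \<phi> \<phi>\<Phi> t])
  have AE\<Phi>: "AE s in lborel. s \<in> {0<..<T} \<longrightarrow> ip \<Omega> (\<Phi> s) (e j) = (LINT r:{0..s}|lborel. ip \<Omega> (\<Psi> r) (e j))" for j
    by (rule AE_coeff_eq[OF op e Psi Phi \<phi> \<phi>\<Phi> t])
  have "(LINT s:{0..t}|lborel. ip \<Omega> (M s) (e j) * ip \<Omega> (\<Phi> s) (e j)) \<le> 0" (is "?I j \<le> 0") for j
  proof (cases "c j = 0")
    \<comment> \<open>With \<open>c j = 0\<close> the equation says nothing about \<open>M\<close>,
      but it makes the coefficient of \<Psi> vanish almost everywhere, and with it that of
      \<Phi>.\<close>
    case True
    have zero: "(LINT r:{0..s}|lborel. ip \<Omega> (\<Psi> r) (e j)) = 0" if "s \<in> {0..T}" for s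
    proof -
      have "(LINT r:{0..s}|lborel. ip \<Omega> (\<Psi> r) (e j)) = (LINT r:{0..s}|lborel. 0)"
        using eq[of j] True by (intro set_integral_cong_AE_Ioo[OF _ _ _ that]) auto
      then show ?thesis by simp
    qed
    have "?I j = (LINT s:{0..t}|lborel. 0)"
    proof (rule set_integral_cong_AE_Ioo[OF _ _ _ t])
      show "AE s in lborel. s \<in> {0<..<T} \<longrightarrow> ip \<Omega> (M s) (e j) * ip \<Omega> (\<Phi> s) (e j) = 0"
        using AE\<Phi>[of j] by eventually_elim (auto simp: zero)
    qed measurable
    then show ?thesis by simp
  next
    case False
    have "c j * ?I j = (LINT s:{0..t}|lborel. c j * (ip \<Omega> (M s) (e j) * ip \<Omega> (\<Phi> s) (e j)))"
      by simp
    also have "\<dots> = (LINT s:{0..t}|lborel. (-1) * (ip \<Omega> (\<Psi> s) (e j) * ip \<Omega> (\<Phi> s) (e j)))"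
    proof (rule set_integral_cong_AE_Ioo[OF _ _ _ t])
      show "AE s in lborel. s \<in> {0<..<T} \<longrightarrow> c j * (ip \<Omega> (M s) (e j) * ip \<Omega> (\<Phi> s) (e j))
          = (-1) * (ip \<Omega> (\<Psi> s) (e j) * ip \<Omega> (\<Phi> s) (e j))"
        using eq[of j]
      proof eventually_elim
        case (elim s)
        show ?case
        proof
          assume "s \<in> {0<..<T}"
          with elim have "c j * ip \<Omega> (M s) (e j) = - ip \<Omega> (\<Psi> s) (e j)" by simp
          then show "c j * (ip \<Omega> (M s) (e j) * ip \<Omega> (\<Phi> s) (e j)) = (-1) * (ip \<Omega> (\<Psi> s) (e j) * ip \<Omega> (\<Phi> s) (e j))"
            by (simp add: mult.assoc[symmetric])
        qed
      qed
    qed measurable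
    also have "\<dots> = - ((ip \<Omega> (\<phi> t) (e j))\<^sup>2 / 2)"
      unfolding set_integral_mult_right coeff by simp
    finally have "c j * ?I j \<le> 0" by simp
    moreover have "0 < c j" using False c[of j] by simp
    ultimately show ?thesis by (simp add: mult_le_0_iff)
  qed
  then have "(\<Sum>j<n. ?I j) \<le> 0" for n by (intro sum_nonpos)
  moreover have "(\<lambda>n. \<Sum>j<n. ?I j) \<longlonglongrightarrow> (LINT s:{0..t}|lborel. ip \<Omega> (M s) (\<Phi> s))"
    by (rule Parseval_time_integral[OF op e Mu Phi]) simp
  ultimately show ?thesis by (intro LIMSEQ_le_const2) auto
qed

text \<open>The pairing with \<open>M\<close> is dropped by its sign, the doubled pairing with
  \<open>F\<close> is split by Young's inequality, and Gronwall's lemma is applied to the squared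
  norm of \<phi>.\<close>

lemma energy_estimate:
  assumes op: "open \<Omega>" and e: "ONB \<Omega> e"
    and Psi: "borel_L2T \<Omega> T \<Psi>" and Phi: "borel_L2T \<Omega> T \<Phi>" and Mu: "borel_L2T \<Omega> T M" and F: "borel_L2T \<Omega> T F"
    and \<phi>: "\<And>t. t \<in> {0..T} \<Longrightarrow> AE x in lebesgue_on \<Omega>. \<phi> t x = (LINT s:{0..t}|lborel. \<Psi> s x)"
    and \<phi>\<Phi>: "AE t in lborel. t \<in> {0<..<T} \<longrightarrow> (AE x in lebesgue_on \<Omega>. \<phi> t x = \<Phi> t x)"
    and c: "\<And>j. 0 \<le> c j"
    and eq: "\<And>j. AE t in lborel. t \<in> {0<..<T} \<longrightarrow> ip \<Omega> (\<Psi> t) (e j) + c j * ip \<Omega> (M t) (e j) = 0"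
    and ineq: "AE t in lborel. t \<in> {0<..<T} \<longrightarrow>
       \<tau> * ip \<Omega> (\<Psi> t) (\<Phi> t) \<le> ip \<Omega> (M t) (\<Phi> t) + ip \<Omega> (F t) (\<Phi> t) + L * ip \<Omega> (\<Phi> t) (\<Phi> t)"
    and \<tau>: "0 < \<tau>" and L: "0 \<le> L" and t: "t \<in> {0..T}"
  shows "ip \<Omega> (\<phi> t) (\<phi> t) \<le> (\<integral>s. ip \<Omega> (F s) (F s) \<partial>lborel) / \<tau> * exp ((2 * L + 1) / \<tau> * T)"
proof -
  note ii = borel_L2T_integrable_ip(1)[OF op]
  define y where "y s = ip \<Omega> (\<phi> s) (\<phi> s)" for s
  define N where "N = (\<integral>s. ip \<Omega> (F s) (F s) \<partial>lborel)"
  have N0: "0 \<le> N" unfolding N_def by (simp add: ip_self_nonneg)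
  have yint: "y s = 2 * (LINT r:{0..s}|lborel. ip \<Omega> (\<Psi> r) (\<Phi> r))" if "s \<in> {0..T}" for s
    unfolding y_def by (rule total_energy_identity[OF op e Psi Phi \<phi> \<phi>\<Phi> that])
  have si: "set_integrable lborel A f" if "integrable lborel f" "A \<in> sets borel" for A and f :: "real \<Rightarrow> real"
    using that unfolding set_integrable_def by (intro integrable_mult_indicator) auto
  \<comment> \<open>Gronwall's lemma needs continuity, which comes from the formula for
    \<open>y\<close> as an indefinite integral; that formula holds at every time.\<close>
  have cont: "continuous_on {0..T} y"
  proof -
    let ?k = "\<lambda>r. ip \<Omega> (\<Psi> r) (\<Phi> r)"
    have "continuous_on {0..T} (\<lambda>s. 2 * integral {0..s} ?k)"
      by (intro continuous_intros indefinite_integral_continuous_1 set_borel_integral_eq_integral(1) si[OF ii[OF Psi Phi]]) simp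
    moreover have "2 * integral {0..s} ?k = y s" if "s \<in> {0..T}" for s
      using yint[OF that] set_borel_integral_eq_integral(2)[OF si[OF ii[OF Psi Phi]], of "{0..s}"] by simp
    ultimately show ?thesis by (rule continuous_on_eq)
  qed
  \<comment> \<open>The estimate below integrates the representative \<Phi>, whereas Gronwall's
    lemma integrates \<open>y\<close>.\<close>
  have Phi_y: "(LINT s:{0..t}|lborel. ip \<Omega> (\<Phi> s) (\<Phi> s)) = integral {0..t} y" if t: "t \<in> {0..T}" for t
  proof -
    have sy: "set_integrable lborel {0..T} y" by (rule borel_integrable_atLeastAtMost'[OF cont])
    \<comment> \<open>The indicator makes the right side measurable on the whole line, as nothing is
      known of \<open>y\<close> outside \<open>{0..T}\<close>.\<close>
    have AEy: "AE s in lborel. s \<in> {0<..<T} \<longrightarrow> ip \<Omega> (\<Phi> s) (\<Phi> s) = indicator {0..T} s *\<^sub>R y s"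
      using \<phi>\<Phi> borel_L2T_AE_L2[OF op Phi]
    proof eventually_elim
      case (elim s)
      show ?case
      proof
        assume s: "s \<in> {0<..<T}"
        have "L2 \<Omega> (\<phi> s)" using s by (intro time_integral_L2(1)[OF op Psi _ \<phi>]) auto
        then have "ip \<Omega> (\<Phi> s) (\<Phi> s) = y s"
          unfolding y_def using elim s by (intro ip_cong_AE) (auto elim: eventually_mono)
        then show "ip \<Omega> (\<Phi> s) (\<Phi> s) = indicator {0..T} s *\<^sub>R y s" using s by simp
      qed
    qed
    have "(LINT s:{0..t}|lborel. ip \<Omega> (\<Phi> s) (\<Phi> s)) = (LINT s:{0..t}|lborel. indicator {0..T} s *\<^sub>R y s)"
      by (rule set_integral_cong_AE_Ioo[OF _ _ AEy t])
        (use ii[OF Phi Phi] sy in \<open>auto simp: set_integrable_def\<close>)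
    also have "\<dots> = (LINT s:{0..t}|lborel. y s)"
      unfolding set_lebesgue_integral_def using t
      by (intro Bochner_Integration.integral_cong) (auto simp: indicator_def)
    also have "\<dots> = integral {0..t} y"
      by (rule set_borel_integral_eq_integral(2)[OF set_integrable_subset[OF sy]]) (use t in auto)
    finally show ?thesis .
  qed
  have "y t \<le> N / \<tau> + (2 * L + 1) / \<tau> * integral {0..t} y" if t: "t \<in> {0..T}" for t
  proof -
    let ?J = "\<lambda>p q. LINT s:{0..t}|lborel. ip \<Omega> (p s) (q s)"
    have ints: "set_integrable lborel {0..t} (\<lambda>s. ip \<Omega> (p s) (q s))" if "borel_L2T \<Omega> T p" "borel_L2T \<Omega> T q" for p q
      by (rule si[OF ii[OF that]]) simp
    note ints' = ints[OF Psi Phi] ints[OF Mu Phi] ints[OF F F] ints[OF Phi Phi]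
    have "\<tau> * y t = (LINT s:{0..t}|lborel. 2 * \<tau> * ip \<Omega> (\<Psi> s) (\<Phi> s))"
      using yint[OF t] by simp
    also have "\<dots> \<le> (LINT s:{0..t}|lborel. 2 * ip \<Omega> (M s) (\<Phi> s) + (ip \<Omega> (F s) (F s) + (2 * L + 1) * ip \<Omega> (\<Phi> s) (\<Phi> s)))"
    proof (rule set_integral_mono_AE)
      show "AE s \<in> {0..t} in lborel. 2 * \<tau> * ip \<Omega> (\<Psi> s) (\<Phi> s)
          \<le> 2 * ip \<Omega> (M s) (\<Phi> s) + (ip \<Omega> (F s) (F s) + (2 * L + 1) * ip \<Omega> (\<Phi> s) (\<Phi> s))"
        using ineq borel_L2T_AE_L2[OF op F] borel_L2T_AE_L2[OF op Phi] AE_lborel_singleton[of 0] AE_lborel_singleton[of T]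
      proof eventually_elim
        case (elim s)
        show ?case
        proof
          assume "s \<in> {0..t}"
          with elim t have "\<tau> * ip \<Omega> (\<Psi> s) (\<Phi> s) \<le> ip \<Omega> (M s) (\<Phi> s) + ip \<Omega> (F s) (\<Phi> s) + L * ip \<Omega> (\<Phi> s) (\<Phi> s)"
            by auto
          with ip_double_le[OF elim(2,3)]
          show "2 * \<tau> * ip \<Omega> (\<Psi> s) (\<Phi> s)
            \<le> 2 * ip \<Omega> (M s) (\<Phi> s) + (ip \<Omega> (F s) (F s) + (2 * L + 1) * ip \<Omega> (\<Phi> s) (\<Phi> s))"
            by (simp add: distrib_right)
        qed
      qed
    qed (use ints' in \<open>auto intro!: set_integral_add set_integrable_mult_right\<close>)
    also have "\<dots> = 2 * ?J M \<Phi> + (?J F F + (2 * L + 1) * ?J \<Phi> \<Phi>)"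
      using ints' by (simp add: set_integral_add set_integrable_mult_right)
    also have "\<dots> \<le> N + (2 * L + 1) * integral {0..t} y"
    proof -
      have "?J M \<Phi> \<le> 0" by (rule potential_pairing_nonpos[OF op e Psi Phi Mu \<phi> \<phi>\<Phi> c eq t])
      \<comment> \<open>Enlarging to all times makes the constant term in Gronwall's lemma
        independent of t.\<close>
      moreover have "?J F F \<le> N"
        unfolding N_def set_lebesgue_integral_def
        using ii[OF F F] ints[OF F F]
        by (intro integral_mono) (auto simp: set_integrable_def indicator_def ip_self_nonneg)
      ultimately show ?thesis by (simp add: Phi_y[OF t])
    qed
    finally show ?thesis using \<tau> by (simp add: field_simps)
  qed
  then have "y t \<le> N / \<tau> * exp ((2 * L + 1) / \<tau> * t)"
    using \<tau> L by (intro Gronwall_integral[OF cont _ _ t]) auto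
  also have "\<dots> \<le> N / \<tau> * exp ((2 * L + 1) / \<tau> * T)"
    using t \<tau> L N0 by (intro mult_left_mono) (auto intro!: mult_left_mono divide_right_mono)
  finally show ?thesis by (simp add: y_def N_def)
qed

section \<open>From solutions to representatives of their differences\<close>

lemma AE_lborel_of_AE_Ioo:
  "(AE t in lebesgue_on {0<..<T::real}. P t) \<Longrightarrow> AE t in lborel. t \<in> {0<..<T} \<longrightarrow> P t"
  by (simp add: AE_lebesgue_on_iff)

text \<open>The test functions are the eigenvectors. The weak equation holds for all test functions
  outside one null set of times, so a single null set serves all j.\<close>

lemma limiting_solution_coeff_equation:
  assumes op: "open \<Omega>" and fin: "finite_measure (lebesgue_on \<Omega>)" and sd: "spectral_data \<Omega> lam e" and r: "0 < r"
    and sol: "limiting_solution \<Omega> lam e lam' e' r \<tau> T \<beta> \<pi> \<phi>0 f \<phi> \<psi> \<mu>"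
  shows "AE t in lborel. t \<in> {0<..<T} \<longrightarrow> (\<forall>j. ip \<Omega> (\<psi> t) (e j) + (lam j powr r)\<^sup>2 * ip \<Omega> (\<mu> t) (e j) = 0)"
proof -
  have e: "ONB \<Omega> e" using sd by (simp add: spectral_data_def)
  have "AE t in lebesgue_on {0<..<T}. \<mu> t \<in> spec_dom \<Omega> lam e (2 * r)"
    and "AE t in lebesgue_on {0<..<T}. \<forall>v \<in> spec_dom \<Omega> lam e r.
        ip \<Omega> (\<psi> t) v + ip \<Omega> (spec_pow \<Omega> lam e r (\<mu> t)) (spec_pow \<Omega> lam e r v) = 0"
    using sol by (auto simp: limiting_solution_def L2T_dom_def)
  then have "AE t in lebesgue_on {0<..<T}. \<forall>j. ip \<Omega> (\<psi> t) (e j) + (lam j powr r)\<^sup>2 * ip \<Omega> (\<mu> t) (e j) = 0"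
  proof eventually_elim
    case (elim t)
    have "\<mu> t \<in> spec_dom \<Omega> lam e r"
      using elim(1) spec_dom_antimono[OF sd, of r "2 * r"] r by auto
    then show ?case
      using elim(2) basis_in_spec_dom[OF e] ip_spec_pow_basis[OF e fin] by metis
  qed
  then show ?thesis by (rule AE_lborel_of_AE_Ioo)
qed

text \<open>The common initial value cancels. At almost every x, \<psi>1 - \<psi>2 is replaced by
  \<Psi>, which equals it for almost every time, so the right side becomes the integral of a Borel
  function.\<close>

lemma time_deriv_difference:
  assumes op: "open \<Omega>"
    and h1: "has_time_deriv \<Omega> T \<phi>1 \<psi>1" "AE x in lebesgue_on \<Omega>. \<phi>1 0 x = \<phi>0 x"
    and h2: "has_time_deriv \<Omega> T \<phi>2 \<psi>2" "AE x in lebesgue_on \<Omega>. \<phi>2 0 x = \<phi>0 x"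
    and Psi: "borel_L2T \<Omega> T \<Psi>"
      "AE x in lebesgue_on \<Omega>. AE t in lborel. t \<in> {0<..<T} \<longrightarrow> \<psi>1 t x - \<psi>2 t x = \<Psi> t x"
    and t: "t \<in> {0..T}"
  shows "AE x in lebesgue_on \<Omega>. \<phi>1 t x - \<phi>2 t x = (LINT s:{0..t}|lborel. \<Psi> s x)"
proof -
  have p1: "AE x in lebesgue_on \<Omega>. \<phi>1 t x = \<phi>1 0 x + (LINT s:{0..t}|lborel. \<psi>1 s x)"
    and p2: "AE x in lebesgue_on \<Omega>. \<phi>2 t x = \<phi>2 0 x + (LINT s:{0..t}|lborel. \<psi>2 s x)"
    and i1: "AE x in lebesgue_on \<Omega>. set_integrable lborel {0..T} (\<lambda>s. \<psi>1 s x)"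
    and i2: "AE x in lebesgue_on \<Omega>. set_integrable lborel {0..T} (\<lambda>s. \<psi>2 s x)"
    using h1 h2 t by (auto simp: has_time_deriv_def)
  have pm: "(\<lambda>(t, x). \<Psi> t x) \<in> borel_measurable (lborel \<Otimes>\<^sub>M lborel)"
    using Psi(1) by (simp add: borel_L2T_def)
  have slice: "(\<lambda>s. \<Psi> s x) \<in> borel_measurable lborel" for x
  proof -
    have "(\<lambda>s. (\<lambda>(t, x). \<Psi> t x) (s, x)) \<in> borel_measurable lborel"
      by (intro measurable_compose[OF measurable_Pair2' pm]) simp
    then show ?thesis by simp
  qed
  from p1 p2 i1 i2 h1(2) h2(2) Psi(2) show ?thesis
  proof eventually_elim
    case (elim x)
    have s1: "set_integrable lborel {0..t} (\<lambda>s. \<psi>1 s x)" and s2: "set_integrable lborel {0..t} (\<lambda>s. \<psi>2 s x)"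
      using elim(3,4) t by (auto intro: set_integrable_subset)
    have "\<phi>1 t x - \<phi>2 t x = (LINT s:{0..t}|lborel. \<psi>1 s x) - (LINT s:{0..t}|lborel. \<psi>2 s x)"
      using elim by simp
    also have "\<dots> = (LINT s:{0..t}|lborel. \<psi>1 s x - \<psi>2 s x)"
      using s1 s2 by (simp add: set_integral_diff)
    also have "\<dots> = (LINT s:{0..t}|lborel. \<Psi> s x)"
      unfolding set_lebesgue_integral_def
    proof (rule integral_cong_AE)
      show "(\<lambda>s. indicator {0..t} s *\<^sub>R (\<psi>1 s x - \<psi>2 s x)) \<in> borel_measurable lborel"
        using set_integral_diff(1)[OF s1 s2] by (auto simp: set_integrable_def)
      show "(\<lambda>s. indicator {0..t} s *\<^sub>R \<Psi> s x) \<in> borel_measurable lborel"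
        using slice by measurable
      show "AE s in lborel. indicator {0..t} s *\<^sub>R (\<psi>1 s x - \<psi>2 s x) = indicator {0..t} s *\<^sub>R \<Psi> s x"
        using elim(7) AE_lborel_singleton[of 0] AE_lborel_singleton[of T]
        by eventually_elim (use t in \<open>auto simp: indicator_def\<close>)
    qed
    finally show ?case .
  qed
qed

text \<open>The constant is chosen before the domain, the operators and the nonlinearities, so it
  depends on \<tau>, L and T alone. For equal forcing terms the right side is 0, which is the
  uniqueness of the first component.\<close>

theorem theorem2p10:
  fixes \<tau> T L :: real
  assumes "0 < \<tau>" and "0 < T" and "0 \<le> L"
  shows "\<exists>C::real. \<forall>\<Omega> lam e lam' e' r \<sigma>0 \<beta> \<pi>h \<pi> \<phi>0 f1 f2 \<phi>1 \<phi>2 \<psi>1 \<psi>2 \<mu>1 \<mu>2.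
     setting \<Omega> lam e lam' e' r \<sigma>0 \<tau> \<beta> \<pi>h \<pi> L \<and>
     \<phi>0 \<in> spec_dom \<Omega> lam' e' \<sigma>0 \<and> int_beta \<Omega> \<beta> \<phi>0 < \<infinity> \<and>
     L2T \<Omega> T f1 \<and> L2T \<Omega> T f2 \<and>
     limiting_solution \<Omega> lam e lam' e' r \<tau> T \<beta> \<pi> \<phi>0 f1 \<phi>1 \<psi>1 \<mu>1 \<and>
     limiting_solution \<Omega> lam e lam' e' r \<tau> T \<beta> \<pi> \<phi>0 f2 \<phi>2 \<psi>2 \<mu>2
     \<longrightarrow> (\<forall>t\<in>{0..T}. nrm \<Omega> (\<lambda>x. \<phi>1 t x - \<phi>2 t x)
                        \<le> C * L2T_norm \<Omega> T (\<lambda>t x. f1 t x - f2 t x))"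
proof (rule exI[of _ "sqrt (exp ((2 * L + 1) / \<tau> * T) / \<tau>)"], intro allI impI ballI, elim conjE)
  fix \<Omega> lam e lam' e' r \<sigma>0 \<beta> \<pi>h \<pi> \<phi>0 f1 f2 \<phi>1 \<phi>2 \<psi>1 \<psi>2 \<mu>1 \<mu>2 t
  assume set: "setting \<Omega> lam e lam' e' r \<sigma>0 \<tau> \<beta> \<pi>h \<pi> L"
    and f1: "L2T \<Omega> T f1" and f2: "L2T \<Omega> T f2"
    and sol1: "limiting_solution \<Omega> lam e lam' e' r \<tau> T \<beta> \<pi> \<phi>0 f1 \<phi>1 \<psi>1 \<mu>1"
    and sol2: "limiting_solution \<Omega> lam e lam' e' r \<tau> T \<beta> \<pi> \<phi>0 f2 \<phi>2 \<psi>2 \<mu>2"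
    and t: "t \<in> {0..T}"
  have op: "open \<Omega>" and bd: "bounded \<Omega>" and sd: "spectral_data \<Omega> lam e" and sd': "spectral_data \<Omega> lam' e'"
    and r: "0 < r" and beta0: "\<beta> 0 = 0" and lip: "\<forall>a b. \<bar>\<pi> a - \<pi> b\<bar> \<le> L * \<bar>a - b\<bar>"
    using set unfolding setting_def by blast+
  have e: "ONB \<Omega> e" using sd by (simp add: spectral_data_def)
  have fin: "finite_measure (lebesgue_on \<Omega>)"
    using op bd emeasure_bounded_finite[OF bd]
    by (intro finite_measureI) (auto simp: emeasure_restrict_space space_restrict_space)
  have h1: "has_time_deriv \<Omega> T \<phi>1 \<psi>1" "AE x in lebesgue_on \<Omega>. \<phi>1 0 x = \<phi>0 x"
    and h2: "has_time_deriv \<Omega> T \<phi>2 \<psi>2" "AE x in lebesgue_on \<Omega>. \<phi>2 0 x = \<phi>0 x"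
    and m1: "L2T \<Omega> T \<mu>1" and m2: "L2T \<Omega> T \<mu>2"
    using sol1 sol2 by (auto simp: limiting_solution_def L2T_dom_def)
  have p1: "L2T \<Omega> T \<phi>1" "L2T \<Omega> T \<psi>1" and p2: "L2T \<Omega> T \<phi>2" "L2T \<Omega> T \<psi>2"
    using h1 h2 by (auto simp: has_time_deriv_def)
  \<comment> \<open>Representatives are taken of the differences, one Borel function per quantity,
    and the norm of f1 - f2 is computed from \<open>F\<close>.\<close>
  obtain F where F: "borel_L2T \<Omega> T F"
    "AE z in lborel \<Otimes>\<^sub>M lborel. z \<in> {0<..<T} \<times> \<Omega> \<longrightarrow> f1 (fst z) (snd z) - f2 (fst z) (snd z) = F (fst z) (snd z)"
    "(L2T_norm \<Omega> T (\<lambda>t x. f1 t x - f2 t x))\<^sup>2 = (\<integral>(t, x). (F t x)\<^sup>2 \<partial>(lborel \<Otimes>\<^sub>M lborel))"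
    using L2T_ex_borel_L2T[OF op L2T_diff[OF f1 f2]] by blast
  obtain \<Psi> where Psi: "borel_L2T \<Omega> T \<Psi>"
    "AE z in lborel \<Otimes>\<^sub>M lborel. z \<in> {0<..<T} \<times> \<Omega> \<longrightarrow> \<psi>1 (fst z) (snd z) - \<psi>2 (fst z) (snd z) = \<Psi> (fst z) (snd z)"
    using L2T_ex_borel_L2T[OF op L2T_diff[OF p1(2) p2(2)]] by blast
  obtain \<Phi> where Phi: "borel_L2T \<Omega> T \<Phi>"
    "AE z in lborel \<Otimes>\<^sub>M lborel. z \<in> {0<..<T} \<times> \<Omega> \<longrightarrow> \<phi>1 (fst z) (snd z) - \<phi>2 (fst z) (snd z) = \<Phi> (fst z) (snd z)"
    using L2T_ex_borel_L2T[OF op L2T_diff[OF p1(1) p2(1)]] by blast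
  obtain M where Mu: "borel_L2T \<Omega> T M"
    "AE z in lborel \<Otimes>\<^sub>M lborel. z \<in> {0<..<T} \<times> \<Omega> \<longrightarrow> \<mu>1 (fst z) (snd z) - \<mu>2 (fst z) (snd z) = M (fst z) (snd z)"
    using L2T_ex_borel_L2T[OF op L2T_diff[OF m1 m2]] by blast
  note slices = AE_slices_eq(1)[OF op F(2)] AE_slices_eq(1)[OF op Psi(2)] AE_slices_eq(1)[OF op Phi(2)] AE_slices_eq(1)[OF op Mu(2)]
    and BL2 = borel_L2T_AE_L2[OF op F(1)] borel_L2T_AE_L2[OF op Psi(1)] borel_L2T_AE_L2[OF op Phi(1)] borel_L2T_AE_L2[OF op Mu(1)]
    and L2s = p1[THEN L2T_AE_L2[OF op]] p2[THEN L2T_AE_L2[OF op]] m1[THEN L2T_AE_L2[OF op]] m2[THEN L2T_AE_L2[OF op]]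
      f1[THEN L2T_AE_L2[OF op]] f2[THEN L2T_AE_L2[OF op]]
  have V1: "AE t in lborel. t \<in> {0<..<T} \<longrightarrow> (\<forall>v. L2 \<Omega> v \<longrightarrow>
        ereal (\<tau> * ip \<Omega> (\<psi>1 t) (\<lambda>x. \<phi>1 t x - v x)
               + ip \<Omega> (\<lambda>x. \<phi>1 t x - ker_proj \<Omega> lam' e' (\<phi>1 t) x) (\<lambda>x. \<phi>1 t x - v x))
        + enn2ereal (int_beta \<Omega> \<beta> (\<phi>1 t))
        + ereal (ip \<Omega> (\<lambda>x. \<pi> (\<phi>1 t x) - f1 t x) (\<lambda>x. \<phi>1 t x - v x))
        \<le> ereal (ip \<Omega> (\<mu>1 t) (\<lambda>x. \<phi>1 t x - v x)) + enn2ereal (int_beta \<Omega> \<beta> v))"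
    by (rule AE_lborel_of_AE_Ioo) (use sol1 in \<open>simp add: limiting_solution_def\<close>)
  have V2: "AE t in lborel. t \<in> {0<..<T} \<longrightarrow> (\<forall>v. L2 \<Omega> v \<longrightarrow>
        ereal (\<tau> * ip \<Omega> (\<psi>2 t) (\<lambda>x. \<phi>2 t x - v x)
               + ip \<Omega> (\<lambda>x. \<phi>2 t x - ker_proj \<Omega> lam' e' (\<phi>2 t) x) (\<lambda>x. \<phi>2 t x - v x))
        + enn2ereal (int_beta \<Omega> \<beta> (\<phi>2 t))
        + ereal (ip \<Omega> (\<lambda>x. \<pi> (\<phi>2 t x) - f2 t x) (\<lambda>x. \<phi>2 t x - v x))
        \<le> ereal (ip \<Omega> (\<mu>2 t) (\<lambda>x. \<phi>2 t x - v x)) + enn2ereal (int_beta \<Omega> \<beta> v))"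
    by (rule AE_lborel_of_AE_Ioo) (use sol2 in \<open>simp add: limiting_solution_def\<close>)
  note E1 = limiting_solution_coeff_equation[OF op fin sd r sol1]
    and E2 = limiting_solution_coeff_equation[OF op fin sd r sol2]
  \<comment> \<open>The equation is linear, so it passes to the differences; at almost every time
    their coefficients equal those of the representatives.\<close>
  have eq: "AE t in lborel. t \<in> {0<..<T} \<longrightarrow> ip \<Omega> (\<Psi> t) (e j) + (lam j powr r)\<^sup>2 * ip \<Omega> (M t) (e j) = 0" for j
    using E1 E2 slices(2,4) BL2(2,4) L2s
  proof eventually_elim
    case (elim s)
    show ?case
    proof
      assume s: "s \<in> {0<..<T}"
      note l = elim(7-14)[rule_format, OF s]
      have "ip \<Omega> (\<lambda>x. \<psi>1 s x - \<psi>2 s x) (e j) = ip \<Omega> (\<Psi> s) (e j)"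
        by (rule ip_cong_AE[OF L2_diff[OF l(2,4)] elim(5) ONB_L2[OF e] ONB_L2[OF e] elim(3)[rule_format, OF s]]) simp
      moreover have "ip \<Omega> (\<lambda>x. \<mu>1 s x - \<mu>2 s x) (e j) = ip \<Omega> (M s) (e j)"
        by (rule ip_cong_AE[OF L2_diff[OF l(5,6)] elim(6) ONB_L2[OF e] ONB_L2[OF e] elim(4)[rule_format, OF s]]) simp
      ultimately have ips: "ip \<Omega> (\<Psi> s) (e j) = ip \<Omega> (\<psi>1 s) (e j) - ip \<Omega> (\<psi>2 s) (e j)"
        "ip \<Omega> (M s) (e j) = ip \<Omega> (\<mu>1 s) (e j) - ip \<Omega> (\<mu>2 s) (e j)"
        by (simp_all add: ip_diff_left l ONB_L2[OF e])
      show "ip \<Omega> (\<Psi> s) (e j) + (lam j powr r)\<^sup>2 * ip \<Omega> (M s) (e j) = 0"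
        unfolding ips right_diff_distrib
        using elim(1)[rule_format, OF s, of j] elim(2)[rule_format, OF s, of j]
        by linarith
    qed
  qed
  have ineq: "AE t in lborel. t \<in> {0<..<T} \<longrightarrow>
       \<tau> * ip \<Omega> (\<Psi> t) (\<Phi> t) \<le> ip \<Omega> (M t) (\<Phi> t) + ip \<Omega> (F t) (\<Phi> t) + L * ip \<Omega> (\<Phi> t) (\<Phi> t)"
    using V1 V2 slices BL2 L2s
  proof eventually_elim
    case (elim s)
    show ?case
    proof
      assume s: "s \<in> {0<..<T}"
      note l = elim(11-18)[rule_format, OF s]
      note a = elim(3-6)[rule_format, OF s]
      let ?d = "\<lambda>x. \<phi>1 s x - \<phi>2 s x"
      note d = L2_diff[OF l(1,3)] and B = elim(7-10)
      have ips: "ip \<Omega> (\<lambda>x. \<psi>1 s x - \<psi>2 s x) ?d = ip \<Omega> (\<Psi> s) (\<Phi> s)"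
        "ip \<Omega> (\<lambda>x. \<mu>1 s x - \<mu>2 s x) ?d = ip \<Omega> (M s) (\<Phi> s)"
        "ip \<Omega> (\<lambda>x. f1 s x - f2 s x) ?d = ip \<Omega> (F s) (\<Phi> s)"
        "ip \<Omega> ?d ?d = ip \<Omega> (\<Phi> s) (\<Phi> s)"
        by (rule ip_cong_AE[OF L2_diff[OF l(2,4)] B(2) d B(3) a(2,3)]
            ip_cong_AE[OF L2_diff[OF l(5,6)] B(4) d B(3) a(4,3)]
            ip_cong_AE[OF L2_diff[OF l(7,8)] B(1) d B(3) a(1,3)]
            ip_cong_AE[OF d B(3) d B(3) a(3,3)])+
      show "\<tau> * ip \<Omega> (\<Psi> s) (\<Phi> s) \<le> ip \<Omega> (M s) (\<Phi> s) + ip \<Omega> (F s) (\<Phi> s) + L * ip \<Omega> (\<Phi> s) (\<Phi> s)"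
        unfolding ips[symmetric]
        by (rule variational_inequality_difference[OF fin sd' assms(3) lip beta0 l(1,3,2,4,5,6,7,8)
              elim(1)[THEN mp, OF s] elim(2)[THEN mp, OF s]])
    qed
  qed
  \<comment> \<open>This formula is available at every \<open>s\<close>, which is why the final
    bound holds at every time and not only almost everywhere.\<close>
  have \<phi>: "AE x in lebesgue_on \<Omega>. \<phi>1 s x - \<phi>2 s x = (LINT r:{0..s}|lborel. \<Psi> r x)" if "s \<in> {0..T}" for s
    by (rule time_deriv_difference[OF op h1 h2 Psi(1) AE_slices_eq(2)[OF op Psi(2)] that])
  let ?N = "L2T_norm \<Omega> T (\<lambda>t x. f1 t x - f2 t x)"
  have N: "?N\<^sup>2 = (\<integral>s. ip \<Omega> (F s) (F s) \<partial>lborel)"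
    unfolding F(3) borel_L2T_integrable_ip(2)[OF op F(1) F(1)] by (simp add: power2_eq_square)
  have N0: "0 \<le> ?N" by (simp add: L2T_norm_def case_prod_beta)
  have "ip \<Omega> (\<lambda>x. \<phi>1 t x - \<phi>2 t x) (\<lambda>x. \<phi>1 t x - \<phi>2 t x)
      \<le> (\<integral>s. ip \<Omega> (F s) (F s) \<partial>lborel) / \<tau> * exp ((2 * L + 1) / \<tau> * T)"
    by (rule energy_estimate[OF op e Psi(1) Phi(1) Mu(1) F(1) \<phi> slices(3) _ eq ineq assms(1,3) t]) auto
  also have "\<dots> = exp ((2 * L + 1) / \<tau> * T) / \<tau> * ?N\<^sup>2" by (simp add: N)
  finally have "nrm \<Omega> (\<lambda>x. \<phi>1 t x - \<phi>2 t x) \<le> sqrt (exp ((2 * L + 1) / \<tau> * T) / \<tau> * ?N\<^sup>2)"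
    unfolding nrm_def by (rule real_sqrt_le_mono)
  also have "\<dots> = sqrt (exp ((2 * L + 1) / \<tau> * T) / \<tau>) * ?N"
    unfolding real_sqrt_mult using N0 by simp
  finally show "nrm \<Omega> (\<lambda>x. \<phi>1 t x - \<phi>2 t x) \<le> sqrt (exp ((2 * L + 1) / \<tau> * T) / \<tau>) * ?N" .
qed

end
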